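(* Let $\omega\in(0,1]$, let the randomized compression operator $Q$ satisfy $\mathbb{E}\lVert Q(\mathbf{x})-\mathbf{x}\rVert^2\le(1-\omega)\lVert\mathbf{x}\rVert^2$ for all $\mathbf{x}\in\mathbb{R}^d$, and let $\mathbf{W},\boldsymbol{\phi},\delta,C,\kappa,\beta$ be as in the context. Suppose that for all $i\in[n]$ and all $\mathbf{x},\mathbf{y}\in\mathbb{R}^d$: (1) (bounded variance) $\mathbb{E}_{\xi_i\sim\mathcal{D}_i}\lVert\nabla\tilde f_i(\mathbf{x},\xi_i)-\nabla f_i(\mathbf{x})\rVert^2\le\sigma^2$; (2) (bounded gradients) $\mathbb{E}_{\xi_i\sim\mathcal{D}_i}\lVert\nabla\tilde f_i(\mathbf{x},\xi_i)\rVert^2\le G^2$; (3) ($L$-smoothness, $L>0$) $\lVert\nabla f_i(\mathbf{x})-\nabla f_i(\mathbf{y})\rVert\le L\lVert\mathbf{x}-\mathbf{y}\rVert$. Let $T\ge n$ be an integer, $\eta:=\frac{\sqrt n}{L\sqrt T}$, and $\gamma:=\frac{\omega\delta}{12\beta(\beta+1)(C+1)}$ (with $\gamma\in(0,1]$). Let $\mathbf{X}(t)$, with rows $\mathbf{x}_i(t)^\top$, be generated by the compressed push-sum stochastic gradient iteration given in the context with $\mathbf{X}(0)=\hat{\mathbf{X}}(0)=\mathbf{0}$ and $\mathbf{y}(0)=\mathbf{1}$. Then $$\frac1T\sum_{t=0}^{T-1}\mathbb{E}\Big\lVert\nabla f\Big(\frac1n\sum_{i=1}^n\mathbf{x}_i(t)\Big)\Big\rVert^2\le\frac{C_6}{\sqrt{nT}}+\frac{C_7}{T},$$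 where $$C_6:=2L(f(\mathbf{0})-f^\star)+\sigma^2,\qquad C_7:=\frac{3264\,C^2(C+1)^2\beta^2(\beta+1)^2G^2n}{\omega^2\delta^4\kappa^2}.$$
   Context: Notation: $[n]=\{1,\dots,n\}$; $\mathbf{1}\in\mathbb{R}^n$ is the all-ones vector, $\mathbf{I}$ the $n\times n$ identity; $\lVert\cdot\rVert$ is the Euclidean norm of a vector and the induced (spectral) norm of a square matrix. Problem: for $i\in[n]$, $\tilde f_i:\mathbb{R}^d\times\mathcal{S}_i\to\mathbb{R}$ is agent $i$'s (differentiable in the first argument) loss, $\mathcal{D}_i$ a distribution on $\mathcal{S}_i$, $f_i(\mathbf{x})=\mathbb{E}_{\xi_i\sim\mathcal{D}_i}\tilde f_i(\mathbf{x},\xi_i)$, $f=\frac1n\sum_{i=1}^nf_i$, and $f^\star=\min_{\mathbf{x}\in\mathbb{R}^d}f(\mathbf{x})$ (assumed to exist). Stochastic gradients are unbiased: $\nabla f_i(\mathbf{x})=\mathbb{E}_{\xi_i\sim\mathcal{D}_i}\nabla\tilde f_i(\mathbf{x},\xi_i)$. Network and mixing matrix: $\mathcal{G}=([n],\mathcal{E})$ is a fixed, strongly connected directed graph. $\mathbf{W}\in[0,1]^{n\times n}$ is column stochastic ($\mathbf{1}^\top\mathbf{W}=\mathbf{1}^\top$) and consistent with $\mathcal{G}$ in the sense that, for $i\ne j$, $\mathbf{W}_{ij}=0$ whenever $(j,i)\notin\mathcal{E}$ (every node is counted among its own neighbors). Set $\beta=\lVert\mathbf{W}-\mathbf{I}\rVert$.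 Fix constants $\delta\in(0,1]$, $C,\kappa>0$ and a stochastic vector $\boldsymbol{\phi}\in\mathbb{R}^n$ (nonnegative entries, $\mathbf{1}^\top\boldsymbol{\phi}=1$) such that for all $t\ge0$ and $i\in[n]$: $\mathbf{W}\boldsymbol{\phi}=\boldsymbol{\phi}$, $[\mathbf{W}^t\mathbf{1}]_i\ge\kappa$, and $\lVert\mathbf{W}^t-\boldsymbol{\phi}\mathbf{1}^\top\rVert\le C(1-\delta)^t$ (with $\mathbf{W}^0=\mathbf{I}$ and $0^0=1$). Compression: $Q$ is a randomized map $\mathbb{R}^d\to\mathbb{R}^d$; the expectation in its defining inequality is over its internal randomness. A fresh independent realization of the randomness is used each time an agent applies $Q$. On matrices $Q$ acts row by row. Iteration: with consensus stepsize $\gamma\in(0,1]$ and optimization stepsize $\eta>0$, matrices $\mathbf{X}(t),\hat{\mathbf{X}}(t),\mathbf{U}(t),\mathbf{Z}(t)\in\mathbb{R}^{n\times d}$ (with rows $\mathbf{x}_i(t)^\top,\hat{\mathbf{x}}_i(t)^\top,\mathbf{u}_i(t)^\top,\mathbf{z}_i(t)^\top$) and $\mathbf{y}(t)\in\mathbb{R}^n$ (entries $y_i(t)$) are generated for $t\ge0$ by $$\hat{\mathbf{X}}(t+1)=\hat{\mathbf{X}}(t)+Q(\mathbf{X}(t)-\hat{\mathbf{X}}(t)),\quad \mathbf{U}(t+1)=\mathbf{X}(t)+\gamma(\mathbf{W}-\mathbf{I})\hat{\mathbf{X}}(t+1),$$ $$\mathbf{y}(t+1)=\mathbf{W}\mathbf{y}(t),\quad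 \mathbf{z}_i(t+1)=\frac{\mathbf{u}_i(t+1)}{y_i(t+1)},\quad \mathbf{x}_i(t+1)=\mathbf{u}_i(t+1)-\eta\nabla\tilde f_i(\mathbf{z}_i(t+1),\xi_{i,t+1}),$$ where the samples $\xi_{i,t}\sim\mathcal{D}_i$ are independent across $i$ and $t$ and independent of the compression randomness. $\mathbb{E}$ in the conclusion is over all randomness. *)

theory Defs
  imports "HOL-Analysis.Analysis" "HOL-Probability.Probability"
begin

definition grad :: "('a::real_inner \<Rightarrow> real) \<Rightarrow> 'a \<Rightarrow> 'a" where
  "grad g x = (THE v. GDERIV g x :> v)"

definition spectral_norm :: "real^'n^'n \<Rightarrow> real" where
  "spectral_norm A = onorm ((*v) A)"

text \<open>The library's multiplication (and hence its power) on vectors of vectors is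
  componentwise, so powers of matrices need a definition of their own.\<close>

primrec mat_power :: "real^'n^'n \<Rightarrow> nat \<Rightarrow> real^'n^'n" where
  "mat_power A 0 = mat 1"
| "mat_power A (Suc t) = A ** mat_power A t"

definition row_mean :: "real^'d^'n \<Rightarrow> real^'d" where
  "row_mean A = (1 / real CARD('n)) *\<^sub>R (\<Sum>i\<in>UNIV. A $ i)"


text \<open>An edge \<open>(j, i)\<close> means that \<open>i\<close> receives from \<open>j\<close>. Below, \<open>(\<chi> i j. \<phi> $ i)\<close> is the
  rank one matrix with all columns equal to \<open>\<phi>\<close>.\<close>

locale mixing_matrix =
  fixes E :: "('n::finite \<times> 'n) set"
    and W :: "real^'n^'n"
    and \<phi> :: "real^'n"
    and \<delta> C \<kappa> :: real
  assumes strongly_connected: "\<And>i j. (i, j) \<in> E\<^sup>*"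
    and entries: "\<And>i j. W $ i $ j \<in> {0..1}"
    and column_stochastic: "1 v* W = 1"
    and consistent: "\<And>i j. i \<noteq> j \<Longrightarrow> (j, i) \<notin> E \<Longrightarrow> W $ i $ j = 0"
    and delta: "0 < \<delta>" "\<delta> \<le> 1"
    and C_pos: "0 < C"
    and kappa_pos: "0 < \<kappa>"
    and phi_nonneg: "\<And>i. 0 \<le> \<phi> $ i"
    and phi_sum: "(\<Sum>i\<in>UNIV. \<phi> $ i) = 1"
    and phi_fixed: "W *v \<phi> = \<phi>"
    and mass_bound: "\<And>t i. (mat_power W t *v 1) $ i \<ge> \<kappa>"
    and mixing: "\<And>t. spectral_norm (mat_power W t - (\<chi> i j. \<phi> $ i)) \<le> C * (1 - \<delta>) ^ t"


text \<open>\<open>D i\<close> is the sampling distribution of agent \<open>i\<close>, with \<open>space (D i)\<close> its sample set; these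
  sets may be different subsets of the common type \<open>'s\<close>.\<close>

definition local_loss ::
  "('n \<Rightarrow> 's measure) \<Rightarrow> ('n \<Rightarrow> real^'d \<Rightarrow> 's \<Rightarrow> real) \<Rightarrow> 'n \<Rightarrow> real^'d \<Rightarrow> real" where
  "local_loss D F i x = (\<integral>s. F i x s \<partial>D i)"

definition global_loss ::
  "('n::finite \<Rightarrow> 's measure) \<Rightarrow> ('n \<Rightarrow> real^'d \<Rightarrow> 's \<Rightarrow> real) \<Rightarrow> real^'d \<Rightarrow> real" where
  "global_loss D F x = (\<Sum>i\<in>UNIV. local_loss D F i x) / real CARD('n)"

locale stochastic_losses =
  fixes D :: "'n::finite \<Rightarrow> 's measure"
    and F :: "'n \<Rightarrow> real^'d \<Rightarrow> 's \<Rightarrow> real"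
  assumes prob_D: "\<And>i. prob_space (D i)"
    and loss_integrable: "\<And>i x. integrable (D i) (F i x)"
    and sample_differentiable:
      "\<And>i x s. s \<in> space (D i) \<Longrightarrow> (\<lambda>u. F i u s) differentiable (at x)"
    and local_differentiable: "\<And>i x. local_loss D F i differentiable (at x)"
    and unbiased:
      "\<And>i x. has_bochner_integral (D i) (\<lambda>s. grad (\<lambda>u. F i u s) x) (grad (local_loss D F i) x)"


text \<open>The randomness: \<open>\<xi> i t\<close> (for \<open>t \<ge> 1\<close>) is the sample of agent \<open>i\<close> used at time \<open>t\<close>, and \<open>\<rho> i t\<close>
  is the seed, with law \<open>R\<close>, used when agent \<open>i\<close> applies the compressor at time \<open>t\<close>. The
  two families take values in different types, so their joint independence is written with
  the generated families of events, as in \<open>indep_vars_def2\<close>.\<close>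

locale push_sum_randomness = prob_space M
  for M :: "'w measure" +
  fixes D :: "'n::finite \<Rightarrow> 's measure"
    and R :: "'r measure"
    and \<xi> :: "'n \<Rightarrow> nat \<Rightarrow> 'w \<Rightarrow> 's"
    and \<rho> :: "'n \<Rightarrow> nat \<Rightarrow> 'w \<Rightarrow> 'r"
  assumes sample_measurable: "\<And>i t. 1 \<le> t \<Longrightarrow> \<xi> i t \<in> measurable M (D i)"
    and sample_law: "\<And>i t. 1 \<le> t \<Longrightarrow> distr M (D i) (\<xi> i t) = D i"
    and seed_measurable: "\<And>i t. \<rho> i t \<in> measurable M R"
    and seed_law: "\<And>i t. distr M R (\<rho> i t) = R"
    and independent:
      "indep_sets
        (case_sum (\<lambda>(i, t). {\<xi> i t -` A \<inter> space M | A. A \<in> sets (D i)})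
                  (\<lambda>(i, t). {\<rho> i t -` A \<inter> space M | A. A \<in> sets R}))
        ((UNIV \<times> {1..}) <+> UNIV)"


text \<open>\<open>Q v r\<close> is the outcome of compressing \<open>v\<close> with seed \<open>r\<close>.\<close>

locale push_sum_iteration =
  fixes \<Omega> :: "'w set"
    and W :: "real^'n^'n"
    and F :: "'n::finite \<Rightarrow> real^'d \<Rightarrow> 's \<Rightarrow> real"
    and Q :: "real^'d \<Rightarrow> 'r \<Rightarrow> real^'d"
    and \<xi> :: "'n \<Rightarrow> nat \<Rightarrow> 'w \<Rightarrow> 's"
    and \<rho> :: "'n \<Rightarrow> nat \<Rightarrow> 'w \<Rightarrow> 'r"
    and \<gamma> \<eta> :: real
    and X Xh U Z :: "nat \<Rightarrow> 'w \<Rightarrow> real^'d^'n"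
    and y :: "nat \<Rightarrow> real^'n"
  assumes Xh_step: "\<And>t w. w \<in> \<Omega> \<Longrightarrow>
        Xh (t + 1) w = Xh t w + (\<chi> i. Q ((X t w - Xh t w) $ i) (\<rho> i t w))"
    and U_step: "\<And>t w. w \<in> \<Omega> \<Longrightarrow>
        U (t + 1) w = X t w + \<gamma> *\<^sub>R ((W - mat 1) ** Xh (t + 1) w)"
    and y_step: "\<And>t. y (t + 1) = W *v y t"
    and Z_step: "\<And>t w i. w \<in> \<Omega> \<Longrightarrow>
        Z (t + 1) w $ i = (1 / y (t + 1) $ i) *\<^sub>R (U (t + 1) w $ i)"
    and X_step: "\<And>t w i. w \<in> \<Omega> \<Longrightarrow>
        X (t + 1) w $ i = U (t + 1) w $ i
          - \<eta> *\<^sub>R grad (\<lambda>u. F i u (\<xi> i (t + 1) w)) (Z (t + 1) w $ i)"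

end

theory Submission
  imports Defs
begin

text \<open>Column stochasticity makes the average of the rows of \<open>X t\<close> follow plain stochastic gradient
  descent, except that agent \<open>i\<close> evaluates its gradient at its own estimate \<open>Z (Suc t) w $ i\<close> instead
  of at the average. The usual descent argument for an \<open>L\<close>-smooth function (\<open>expected_descent\<close>) then
  bounds the averaged squared gradient by three terms: the initial gap divided by \<open>\<eta> T\<close>, the
  variance \<open>L \<eta> \<sigma>\<^sup>2 / n\<close>, where the factor \<open>1 / n\<close> comes from the orthogonality of the noises of
  different agents (\<open>noise_sum_moment\<close>), and the mean squared distance of the estimates to the average.
  With \<open>\<eta> = sqrt n / (L sqrt T)\<close> the first two give \<open>C6\<close> and the last one, being of order \<open>\<eta>\<^sup>2\<close>,
  gives \<open>C7\<close>.

  The distance to the average (\<open>disagreement_moment\<close>) has two sources. The first is the deviation of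
  \<open>X t\<close> from its limit profile \<open>\<phi> 1\<^sup>T X t\<close>. It obeys a linear recursion with matrix
  \<open>A = I + \<gamma> (W - I)\<close>, driven by compression residuals and gradients. A single application of \<open>A\<close> need
  not be a contraction, but its powers approach \<open>\<phi> 1\<^sup>T\<close> at rate \<open>(1 - \<gamma> \<delta>)\<^sup>k\<close>
  (\<open>spectral_norm_mat_power_lazy\<close>), so the recursion is unrolled completely and estimated term by
  term. The compression error in turn is contracted by \<open>sqrt (1 - \<omega>)\<close> in each step and fed by the
  deviation; the choice of \<open>\<gamma>\<close> makes this feedback loop stable (\<open>coupled_errors_bounded\<close>). The second
  source is the gap between the push-sum weights \<open>y t\<close> and their limit \<open>n \<phi>\<close>. It decays geometrically,
  whereas the average moves away from the origin at most linearly in \<open>t\<close>, and \<open>t (1 - \<delta>)\<^sup>t\<close> is at most \<open>1 / \<delta>\<close>.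

  All sizes of random quantities are measured by the norm of \<open>L\<^sup>2\<close>, whose triangle inequality lets the
  deterministic estimates go through verbatim. Randomness enters in two ways only: an
  independent sample or seed may be integrated out with its partner frozen
  (\<open>square_integrable_product_law\<close>), and centred noise is orthogonal to everything independent of it
  (\<open>integral_inner_indep_centred\<close>).\<close>


section \<open>Gradients and the descent inequality\<close>

lemma GDERIV_unique:
  assumes "GDERIV f x :> v" "GDERIV f x :> w"
  shows "v = w"
proof -
  have "(\<lambda>h. h \<bullet> v) = (\<lambda>h. h \<bullet> w)"
    using assms has_derivative_unique unfolding gderiv_def by blast
  then have "h \<bullet> (v - w) = 0" for h
    by (metis inner_diff_right right_minus_eq)
  then show ?thesis
    using inner_eq_zero_iff[of "v - w"] by simp
qed

lemma grad_eqI: "GDERIV f x :> v \<Longrightarrow> grad f x = v"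
  unfolding grad_def using GDERIV_unique by blast

lemma GDERIV_grad:
  fixes f :: "'a::euclidean_space \<Rightarrow> real"
  assumes "f differentiable (at x)"
  shows "GDERIV f x :> grad f x"
proof -
  obtain f' where f': "(f has_derivative f') (at x)"
    using assms unfolding differentiable_def by blast
  have "h \<bullet> adjoint f' 1 = f' h" for h
    using adjoint_works[OF has_derivative_linear[OF f'], of h 1] by simp
  then have "GDERIV f x :> adjoint f' 1"
    using f' unfolding gderiv_def by simp
  then show ?thesis
    using grad_eqI by metis
qed

lemma GDERIV_line:
  fixes f :: "'a::euclidean_space \<Rightarrow> real"
  assumes "\<And>x. f differentiable (at x)"
  shows "((\<lambda>s. f (x + s *\<^sub>R v)) has_real_derivative v \<bullet> grad f (x + s *\<^sub>R v)) (at s)"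
proof -
  have "(f has_derivative (\<lambda>h. h \<bullet> grad f (x + s *\<^sub>R v))) (at (x + s *\<^sub>R v))"
    using GDERIV_grad[OF assms] unfolding gderiv_def by blast
  moreover have "((\<lambda>s. x + s *\<^sub>R v) has_derivative (\<lambda>h. h *\<^sub>R v)) (at s)"
    by (auto intro!: derivative_eq_intros)
  ultimately have "((\<lambda>s. f (x + s *\<^sub>R v)) has_derivative (\<lambda>h. (h *\<^sub>R v) \<bullet> grad f (x + s *\<^sub>R v))) (at s)"
    using has_derivative_compose by blast
  then show ?thesis
    unfolding has_field_derivative_def by (simp add: mult.commute[of "v \<bullet> _"] mult_commute_abs)
qed

text \<open>Along the segment from \<open>x\<close> to \<open>x + v\<close> the gap between the two sides is monotone, because
  its slope is controlled by the Lipschitz bound and the Cauchy-Schwarz inequality.\<close>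

lemma descent_inequality:
  fixes f :: "'a::euclidean_space \<Rightarrow> real"
  assumes diff: "\<And>x. f differentiable (at x)"
    and lip: "\<And>x y. norm (grad f x - grad f y) \<le> L * norm (x - y)"
  shows "f (x + v) \<le> f x + grad f x \<bullet> v + L / 2 * (norm v)\<^sup>2"
proof -
  define p where "p s = f (x + s *\<^sub>R v) - s * (grad f x \<bullet> v) - L / 2 * (norm v)\<^sup>2 * s\<^sup>2" for s
  have p': "(p has_real_derivative
      v \<bullet> grad f (x + s *\<^sub>R v) - grad f x \<bullet> v - L * (norm v)\<^sup>2 * s) (at s)" for s
    unfolding p_def by (auto intro!: derivative_eq_intros GDERIV_line diff)
  have "p 1 \<le> p 0"
  proof (rule DERIV_nonpos_imp_nonincreasing[where f = p])
    fix s :: real assume s: "0 \<le> s" "s \<le> 1"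
    have "v \<bullet> grad f (x + s *\<^sub>R v) - grad f x \<bullet> v = v \<bullet> (grad f (x + s *\<^sub>R v) - grad f x)"
      by (simp add: inner_diff_right inner_commute)
    also have "\<dots> \<le> norm v * norm (grad f (x + s *\<^sub>R v) - grad f x)"
      by (rule norm_cauchy_schwarz)
    also have "\<dots> \<le> norm v * (L * norm (s *\<^sub>R v))"
      using lip[of "x + s *\<^sub>R v" x] by (intro mult_left_mono) auto
    also have "\<dots> = L * (norm v)\<^sup>2 * s"
      using s by (simp add: power2_eq_square)
    finally show "\<exists>y. (p has_real_derivative y) (at s) \<and> y \<le> 0"
      using p' by (intro exI conjI) auto
  qed simp
  then show ?thesis
    by (simp add: p_def)
qed


section \<open>Joint measurability of sample gradients\<close>

text \<open>Rounding to the grid of mesh \<open>1 / Suc n\<close> takes countably many values, so a function that is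
  measurable in its second argument alone becomes jointly measurable after rounding the first;
  continuity in the first argument lets the mesh tend to zero.\<close>

definition grid_round :: "nat \<Rightarrow> real^'d \<Rightarrow> real^'d" where
  "grid_round n x = (\<chi> k. of_int \<lfloor>real (Suc n) * x $ k\<rfloor> / real (Suc n))"

lemma grid_round_tendsto: "(\<lambda>n. grid_round n x) \<longlonglongrightarrow> x"
proof (rule vec_tendstoI)
  fix k
  show "(\<lambda>n. grid_round n x $ k) \<longlonglongrightarrow> x $ k"
  proof (rule real_tendsto_sandwich)
    show "(\<lambda>n. x $ k - 1 / real (Suc n)) \<longlonglongrightarrow> x $ k"
      using tendsto_diff[OF tendsto_const LIMSEQ_inverse_real_of_nat, of "x $ k"]
      by (simp add: inverse_eq_divide)
    show "\<forall>\<^sub>F n in sequentially. x $ k - 1 / real (Suc n) \<le> grid_round n x $ k"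
    proof (rule always_eventually, rule allI)
      fix n
      have "real (Suc n) * x $ k - 1 \<le> of_int \<lfloor>real (Suc n) * x $ k\<rfloor>"
        by linarith
      then have "(real (Suc n) * x $ k - 1) / real (Suc n)
          \<le> of_int \<lfloor>real (Suc n) * x $ k\<rfloor> / real (Suc n)"
        by (rule divide_right_mono) simp
      then show "x $ k - 1 / real (Suc n) \<le> grid_round n x $ k"
        unfolding grid_round_def by (simp add: diff_divide_distrib del: of_nat_Suc)
    qed
    show "\<forall>\<^sub>F n in sequentially. grid_round n x $ k \<le> x $ k"
    proof (rule always_eventually, rule allI)
      fix n
      have "of_int \<lfloor>real (Suc n) * x $ k\<rfloor> / real (Suc n) \<le> real (Suc n) * x $ k / real (Suc n)"
        by (rule divide_right_mono) linarith+
      then show "grid_round n x $ k \<le> x $ k"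
        unfolding grid_round_def by (simp del: of_nat_Suc)
    qed
  qed simp
qed

lemma borel_measurable_vec_nth [measurable]: "(\<lambda>x. x $ k) \<in> borel_measurable (borel :: ('a::euclidean_space^'n) measure)"
  by (intro borel_measurable_continuous_onI continuous_intros)

lemma borel_measurable_vec_lambda:
  fixes f :: "'n::finite \<Rightarrow> 'w \<Rightarrow> 'a::euclidean_space"
  assumes "\<And>i. f i \<in> borel_measurable M"
  shows "(\<lambda>w. \<chi> i. f i w) \<in> borel_measurable M"
proof -
  have "(\<chi> i. f i w) = (\<Sum>i\<in>UNIV. axis i (f i w))" for w
    by (simp add: vec_eq_iff axis_def)
  moreover have "(\<lambda>x. axis i x) \<in> borel_measurable (borel :: 'a measure)" for i :: 'n
    by (intro borel_measurable_continuous_onI linear_continuous_on)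
       (simp add: linear_conv_bounded_linear[symmetric] linear_iff vec_eq_iff axis_def)
  moreover from calculation(2) have "(\<lambda>w. \<Sum>i\<in>UNIV. axis i (f i w)) \<in> borel_measurable M"
    by (intro borel_measurable_sum measurable_compose[OF assms])
  ultimately show ?thesis
    by simp
qed

lemma borel_measurable_caratheodory:
  fixes g :: "real^'d \<Rightarrow> 's \<Rightarrow> 'b::metric_space"
  assumes meas: "\<And>x. g x \<in> borel_measurable N"
    and cont: "\<And>s. s \<in> space N \<Longrightarrow> continuous_on UNIV (\<lambda>x. g x s)"
  shows "(\<lambda>(x, s). g x s) \<in> borel_measurable (borel \<Otimes>\<^sub>M N)"
proof (rule borel_measurable_LIMSEQ_metric)
  fix p :: "(real^'d) \<times> 's" assume "p \<in> space (borel \<Otimes>\<^sub>M N)"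
  then have "snd p \<in> space N"
    by (auto simp: space_pair_measure)
  then have "isCont (\<lambda>x. g x (snd p)) (fst p)"
    using cont by (simp add: continuous_on_eq_continuous_at)
  then show "(\<lambda>n. g (grid_round n (fst p)) (snd p)) \<longlonglongrightarrow> (\<lambda>(x, s). g x s) p"
    using isCont_tendsto_compose[where g = "\<lambda>x. g x (snd p)", OF _ grid_round_tendsto]
    by (simp add: case_prod_beta)
next
  fix n
  define h where "h c p = g (\<chi> k. of_int (c k) / real (Suc n)) (snd p)" for c :: "'d \<Rightarrow> int" and p :: "(real^'d) \<times> 's"
  have eq: "(\<lambda>p. g (grid_round n (fst p)) (snd p))
      = (\<lambda>p. h (\<lambda>k. \<lfloor>real (Suc n) * fst p $ k\<rfloor>) p)"
    by (simp add: h_def grid_round_def)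
  show "(\<lambda>p. g (grid_round n (fst p)) (snd p)) \<in> borel_measurable (borel \<Otimes>\<^sub>M N)"
    unfolding eq
  proof (rule measurable_compose_countable[where f = h])
    fix c show "h c \<in> borel_measurable (borel \<Otimes>\<^sub>M N)"
      unfolding h_def using measurable_compose[OF measurable_snd meas] by simp
    have "(\<lambda>p. \<lfloor>real (Suc n) * fst p $ k\<rfloor>) \<in> measurable (borel \<Otimes>\<^sub>M N) (count_space UNIV)" for k :: 'd
      by measurable
    then have "{p \<in> space (borel \<Otimes>\<^sub>M N). \<lfloor>real (Suc n) * fst p $ k\<rfloor> = c k}
        \<in> sets (borel \<Otimes>\<^sub>M N)" for k :: 'd and c
      using measurable_sets[of _ "borel \<Otimes>\<^sub>M N" "count_space UNIV" "{c k}"]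
      by (simp add: vimage_def Int_def conj_commute)
    then have "(\<Inter>k. {p \<in> space (borel \<Otimes>\<^sub>M N). \<lfloor>real (Suc n) * fst p $ k\<rfloor> = c k})
        \<in> sets (borel \<Otimes>\<^sub>M N)" for c :: "'d \<Rightarrow> int"
      by (intro sets.finite_INT) auto
    moreover have "\<And>c. (\<lambda>(p::(real^'d) \<times> 's) k. \<lfloor>real (Suc n) * fst p $ k\<rfloor>) -` {c} \<inter> space (borel \<Otimes>\<^sub>M N)
      = (\<Inter>k. {p \<in> space (borel \<Otimes>\<^sub>M N). \<lfloor>real (Suc n) * fst p $ k\<rfloor> = c k})"
      by (auto simp: fun_eq_iff)
    ultimately have "(\<lambda>p (k::'d). \<lfloor>real (Suc n) * fst p $ k\<rfloor>) -` {c} \<inter> space (borel \<Otimes>\<^sub>M N)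
        \<in> sets (borel \<Otimes>\<^sub>M N)" for c :: "'d \<Rightarrow> int"
      by simp
    then show "(\<lambda>p (k::'d). \<lfloor>real (Suc n) * fst p $ k\<rfloor>)
        \<in> measurable (borel \<Otimes>\<^sub>M N) (count_space UNIV)"
      by (subst measurable_count_space_eq_countable) (simp_all del: of_nat_Suc)
  qed
qed

text \<open>Each coordinate of the gradient is a limit of difference quotients, which inherit joint
  measurability from the function itself.\<close>

lemma borel_measurable_grad:
  fixes g :: "real^'d \<Rightarrow> 's \<Rightarrow> real"
  assumes meas: "\<And>x. g x \<in> borel_measurable N"
    and diff: "\<And>x s. s \<in> space N \<Longrightarrow> (\<lambda>u. g u s) differentiable (at x)"
  shows "(\<lambda>(x, s). grad (\<lambda>u. g u s) x) \<in> borel_measurable (borel \<Otimes>\<^sub>M N)"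
proof -
  have g [measurable]: "(\<lambda>(x, s). g x s) \<in> borel_measurable (borel \<Otimes>\<^sub>M N)"
    using meas diff
    by (intro borel_measurable_caratheodory)
       (auto intro!: differentiable_imp_continuous_on simp: differentiable_on_def)
  have "(\<lambda>p. grad (\<lambda>u. g u (snd p)) (fst p) $ k) \<in> borel_measurable (borel \<Otimes>\<^sub>M N)" for k :: 'd
  proof (rule borel_measurable_LIMSEQ_metric)
    fix p :: "(real^'d) \<times> 's" assume "p \<in> space (borel \<Otimes>\<^sub>M N)"
    then have s: "snd p \<in> space N"
      by (auto simp: space_pair_measure)
    let ?x = "fst p" and ?s = "snd p"
    have "((\<lambda>h. g (?x + h *\<^sub>R axis k 1) ?s) has_real_derivative
        axis k 1 \<bullet> grad (\<lambda>u. g u ?s) (?x + 0 *\<^sub>R axis k 1)) (at 0)"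
      using diff[OF s] by (intro GDERIV_line[where f = "\<lambda>u. g u ?s"])
    then have "((\<lambda>h. (g (?x + h *\<^sub>R axis k 1) ?s - g ?x ?s) / h) \<longlongrightarrow>
        grad (\<lambda>u. g u ?s) ?x $ k) (at 0)"
      by (simp add: DERIV_def inner_axis')
    then show "(\<lambda>n. (g (?x + inverse (real (Suc n)) *\<^sub>R axis k 1) ?s - g ?x ?s)
        / inverse (real (Suc n))) \<longlonglongrightarrow> grad (\<lambda>u. g u ?s) ?x $ k"
      by (rule tendsto_compose_eventually[of _ _ _ "\<lambda>n. inverse (real (Suc n))", OF _ LIMSEQ_inverse_real_of_nat])
         simp
  qed measurable
  from borel_measurable_vec_lambda[of "\<lambda>k p. grad (\<lambda>u. g u (snd p)) (fst p) $ k", OF this]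
  show ?thesis
    by (simp add: case_prod_beta)
qed


section \<open>Matrix norms and averaged mixing\<close>

lemma spectral_norm_nonneg: "0 \<le> spectral_norm A"
  unfolding spectral_norm_def by (rule onorm_pos_le) simp

lemma norm_matrix_vector_le: "norm (A *v x) \<le> spectral_norm A * norm x"
  unfolding spectral_norm_def by (rule onorm) simp

lemma spectral_norm_add_le: "spectral_norm (A + B) \<le> spectral_norm A + spectral_norm B"
  unfolding spectral_norm_def matrix_vector_mult_add_rdistrib by (rule onorm_triangle) simp_all

lemma spectral_norm_scaleR: "spectral_norm (r *\<^sub>R A) = \<bar>r\<bar> * spectral_norm A"
  unfolding spectral_norm_def scaleR_matrix_vector_assoc[symmetric] by (rule onorm_scaleR) simp

lemma norm_vec_power2: "(norm (x :: 'a::real_normed_vector^'n))\<^sup>2 = (\<Sum>i\<in>UNIV. (norm (x $ i))\<^sup>2)"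
  by (simp add: norm_vec_def L2_set_def sum_nonneg)

lemma norm_vec_le_scaled:
  fixes x :: "'a::real_normed_vector^'n" and z :: "'b::real_normed_vector^'n"
  assumes "\<And>i. norm (x $ i) \<le> c * norm (z $ i)" "0 \<le> c"
  shows "norm x \<le> c * norm z"
proof (rule power2_le_imp_le)
  have "(norm x)\<^sup>2 \<le> (\<Sum>i\<in>UNIV. (c * norm (z $ i))\<^sup>2)"
    unfolding norm_vec_power2 by (intro sum_mono power_mono assms) simp
  then show "(norm x)\<^sup>2 \<le> (c * norm z)\<^sup>2"
    by (simp add: power_mult_distrib norm_vec_power2 sum_distrib_left)
qed (use assms in simp)

lemma norm_power2_columns:
  fixes A :: "real^'d^'n"
  shows "(norm A)\<^sup>2 = (\<Sum>k\<in>UNIV. (norm (column k A))\<^sup>2)"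
  unfolding norm_vec_power2 column_def by (subst sum.swap) simp

text \<open>The norm of a matrix of row vectors is its Frobenius norm, and the matrix product acts column
  by column.\<close>

lemma norm_matrix_mult_le:
  fixes A :: "real^'n^'n" and X :: "real^'d^'n"
  shows "norm (A ** X) \<le> spectral_norm A * norm X"
proof (rule power2_le_imp_le)
  have "column k (A ** X) = A *v column k X" for k
    by (simp add: vec_eq_iff column_def matrix_matrix_mult_def matrix_vector_mult_def)
  then have "(norm (A ** X))\<^sup>2 \<le> (\<Sum>k\<in>UNIV. (spectral_norm A * norm (column k X))\<^sup>2)"
    unfolding norm_power2_columns[of "A ** X"]
    by (intro sum_mono power_mono) (simp_all add: norm_matrix_vector_le)
  then show "(norm (A ** X))\<^sup>2 \<le> (spectral_norm A * norm X)\<^sup>2"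
    by (simp add: power_mult_distrib norm_power2_columns[of X] sum_distrib_left)
qed (simp add: spectral_norm_nonneg)

interpretation matrix_mult: bounded_bilinear
  "(**) :: real^'n^'m \<Rightarrow> real^'d^'n \<Rightarrow> real^'d^'m"
  by (rule bilinear_conv_bounded_bilinear[THEN iffD1])
     (simp add: bilinear_def linear_iff matrix_matrix_mult_def vec_eq_iff algebra_simps
        sum.distrib sum_distrib_left)

lemma mat_power_Suc_right: "mat_power A (Suc k) = mat_power A k ** A"
  by (induction k) (simp_all add: matrix_mul_assoc)

lemma row_mean_linear: "linear (row_mean :: real^'d^'n \<Rightarrow> real^'d)"
  by (simp add: linear_iff row_mean_def sum.distrib algebra_simps scaleR_sum_right)

lemma row_mean_add: "row_mean (A + B) = row_mean A + row_mean (B :: real^'d^'n)"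
  and row_mean_diff: "row_mean (A - B) = row_mean A - row_mean (B :: real^'d^'n)"
  and row_mean_scaleR: "row_mean (c *\<^sub>R A) = c *\<^sub>R row_mean (A :: real^'d^'n)"
  using linear_add linear_diff linear_scale row_mean_linear by blast+

text \<open>Jensen's inequality for the square, applied to the rows.\<close>

lemma norm_row_mean_power2_le:
  fixes A :: "real^'d^'n"
  shows "(norm (row_mean A))\<^sup>2 \<le> (norm A)\<^sup>2 / real CARD('n)"
proof -
  have "norm (\<Sum>i\<in>UNIV. A $ i) \<le> (\<Sum>i\<in>UNIV. norm (A $ i))"
    by (rule norm_sum)
  then have "(norm (\<Sum>i\<in>UNIV. A $ i))\<^sup>2 \<le> (\<Sum>i\<in>UNIV. norm (A $ i))\<^sup>2"
    by (intro power_mono) auto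
  also have "\<dots> = (\<Sum>i\<in>UNIV. 1 * norm (A $ i))\<^sup>2"
    by simp
  also have "\<dots> \<le> (\<Sum>i\<in>(UNIV::'n set). 1\<^sup>2) * (\<Sum>i\<in>UNIV. (norm (A $ i))\<^sup>2)"
    by (rule Cauchy_Schwarz_ineq_sum)
  also have "\<dots> = real CARD('n) * (norm A)\<^sup>2"
    by (simp add: norm_vec_power2)
  finally show ?thesis
    by (simp add: row_mean_def power_mult_distrib power_divide power2_eq_square field_simps)
qed

context mixing_matrix
begin

text \<open>The limit \<open>\<phi> 1\<^sup>T\<close> of the powers of \<open>W\<close>.\<close>

definition limit_matrix :: "real^'n^'n" where
  "limit_matrix = (\<chi> i j. \<phi> $ i)"

text \<open>The matrix that drives the iterates, in contrast to \<open>W\<close>, which drives the weights.\<close>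

definition lazy_mixing :: "real \<Rightarrow> real^'n^'n" where
  "lazy_mixing \<gamma> = mat 1 + \<gamma> *\<^sub>R (W - mat 1)"

lemma column_sum: "(\<Sum>i\<in>UNIV. W $ i $ j) = 1"
proof -
  have "(1 v* W) $ j = 1"
    by (simp add: column_stochastic)
  then show ?thesis
    by (simp add: vector_matrix_mult_def)
qed

lemma W_limit_matrix: "W ** limit_matrix = limit_matrix"
proof -
  have "(W *v \<phi>) $ i = \<phi> $ i" for i
    by (simp add: phi_fixed)
  then show ?thesis
    by (simp add: vec_eq_iff limit_matrix_def matrix_matrix_mult_def matrix_vector_mult_def)
qed

lemma limit_matrix_W: "limit_matrix ** W = limit_matrix"
  by (simp add: vec_eq_iff limit_matrix_def matrix_matrix_mult_def sum_distrib_left[symmetric] column_sum)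

lemma limit_matrix_lazy_mixing: "limit_matrix ** lazy_mixing \<gamma> = limit_matrix"
  by (simp add: lazy_mixing_def matrix_mult.add_right matrix_mult.scaleR_right
      matrix_mult.diff_right limit_matrix_W)

lemma limit_matrix_mat_power_lazy: "limit_matrix ** mat_power (lazy_mixing \<gamma>) k = limit_matrix"
  by (induction k) (simp_all add: matrix_mul_assoc limit_matrix_lazy_mixing)

lemma row_mean_W: "row_mean ((W - mat 1) ** (X :: real^'d^'n)) = 0"
proof -
  have "(\<Sum>i\<in>UNIV. (W ** X) $ i) = (\<Sum>i\<in>UNIV. X $ i)"
  proof (simp add: vec_eq_iff, intro allI)
    fix k
    have "(\<Sum>i\<in>UNIV. (W ** X) $ i $ k) = (\<Sum>j\<in>UNIV. (\<Sum>i\<in>UNIV. W $ i $ j) * X $ j $ k)"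
      by (simp add: matrix_matrix_mult_def sum_distrib_right) (rule sum.swap)
    then show "(\<Sum>i\<in>UNIV. (W ** X) $ i $ k) = (\<Sum>i\<in>UNIV. X $ i $ k)"
      by (simp add: column_sum)
  qed
  then have "row_mean (W ** X) = row_mean X"
    by (simp add: row_mean_def)
  then show ?thesis
    by (simp add: matrix_mult.diff_left row_mean_diff)
qed

lemma limit_matrix_mult_row:
  fixes X :: "real^'d^'n"
  shows "(limit_matrix ** X) $ i = (real CARD('n) * \<phi> $ i) *\<^sub>R row_mean X"
  by (simp add: vec_eq_iff limit_matrix_def matrix_matrix_mult_def row_mean_def sum_distrib_left)

text \<open>The powers of \<open>W\<close> contract only up to the factor \<open>C\<close>, so one averaged step need not contract
  at all. Bounding every product \<open>W\<^sup>j A\<^sup>k\<close>, with \<open>A\<close> the averaged matrix, makes the estimate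
  inductive: one more factor \<open>A\<close> is the convex combination of leaving \<open>j\<close> alone and of increasing
  it by one, which multiplies the bound by \<open>(1 - \<gamma>) + \<gamma> (1 - \<delta>)\<close>.\<close>

lemma spectral_norm_mat_power_lazy:
  assumes "0 \<le> \<gamma>" "\<gamma> \<le> 1"
  shows "spectral_norm (mat_power W j ** mat_power (lazy_mixing \<gamma>) k - limit_matrix)
    \<le> C * (1 - \<delta>) ^ j * (1 - \<gamma> * \<delta>) ^ k"
proof (induction k arbitrary: j)
  case 0
  then show ?case
    using mixing[of j] by (simp add: limit_matrix_def)
next
  case (Suc k)
  let ?A = "mat_power (lazy_mixing \<gamma>)"
  have "mat_power W j ** lazy_mixing \<gamma> = (1 - \<gamma>) *\<^sub>R mat_power W j + \<gamma> *\<^sub>R mat_power W (Suc j)"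
    unfolding mat_power_Suc_right lazy_mixing_def
    by (simp add: matrix_mult.add_right matrix_mult.scaleR_right matrix_mult.diff_right
        algebra_simps)
  then have "mat_power W j ** ?A (Suc k)
      = (1 - \<gamma>) *\<^sub>R (mat_power W j ** ?A k) + \<gamma> *\<^sub>R (mat_power W (Suc j) ** ?A k)"
    by (simp add: matrix_mul_assoc matrix_mult.add_left matrix_mult.scaleR_left)
  then have "mat_power W j ** ?A (Suc k) - limit_matrix
      = (1 - \<gamma>) *\<^sub>R (mat_power W j ** ?A k - limit_matrix)
        + \<gamma> *\<^sub>R (mat_power W (Suc j) ** ?A k - limit_matrix)"
    by (simp add: algebra_simps)
  then have "spectral_norm (mat_power W j ** ?A (Suc k) - limit_matrix)
      \<le> (1 - \<gamma>) * spectral_norm (mat_power W j ** ?A k - limit_matrix)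
        + \<gamma> * spectral_norm (mat_power W (Suc j) ** ?A k - limit_matrix)"
    using spectral_norm_add_le assms by (metis abs_of_nonneg diff_ge_0_iff_ge spectral_norm_scaleR)
  also have "\<dots> \<le> (1 - \<gamma>) * (C * (1 - \<delta>) ^ j * (1 - \<gamma> * \<delta>) ^ k)
      + \<gamma> * (C * (1 - \<delta>) ^ Suc j * (1 - \<gamma> * \<delta>) ^ k)"
    using assms by (intro add_mono mult_left_mono Suc.IH) auto
  also have "\<dots> = C * (1 - \<delta>) ^ j * (1 - \<gamma> * \<delta>) ^ Suc k"
    by (simp add: algebra_simps)
  finally show ?case .
qed

lemma spectral_norm_lazy_minus_limit:
  assumes "0 \<le> \<gamma>" "\<gamma> \<le> 1"
  shows "spectral_norm (mat_power (lazy_mixing \<gamma>) k - limit_matrix) \<le> C * (1 - \<gamma> * \<delta>) ^ k"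
  using spectral_norm_mat_power_lazy[OF assms, of 0 k] by simp

end

text \<open>Bernoulli's inequality, used in the form \<open>(1 - \<delta>)\<^sup>t (1 + t \<delta>) \<le> (1 - \<delta>\<^sup>2)\<^sup>t\<close>.\<close>

lemma linear_times_geometric_le:
  fixes \<delta> :: real
  assumes "0 < \<delta>" "\<delta> \<le> 1"
  shows "real t * (1 - \<delta>) ^ t \<le> 1 / \<delta>"
proof -
  have "(1 + real t * \<delta>) * (1 - \<delta>) ^ t \<le> (1 + \<delta>) ^ t * (1 - \<delta>) ^ t"
    using assms Bernoulli_inequality[of \<delta> t] by (intro mult_right_mono) auto
  also have "\<dots> = (1 - \<delta>\<^sup>2) ^ t"
    by (simp add: power_mult_distrib[symmetric] algebra_simps power2_eq_square)
  also have "\<dots> \<le> 1"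
    using assms by (intro power_le_one) (simp_all add: power_le_one)
  finally have "real t * \<delta> * (1 - \<delta>) ^ t \<le> 1 - (1 - \<delta>) ^ t"
    by (simp add: algebra_simps)
  moreover have "0 \<le> (1 - \<delta>) ^ t"
    using assms by simp
  ultimately have "real t * \<delta> * (1 - \<delta>) ^ t \<le> 1"
    by linarith
  then show ?thesis
    using assms by (simp add: field_simps)
qed

lemma geometric_sum_le:
  fixes r :: real
  assumes "0 \<le> r" "r < 1"
  shows "(\<Sum>s<t. r ^ (t - 1 - s)) \<le> 1 / (1 - r)"
proof -
  have "(\<Sum>s<t. r ^ (t - 1 - s)) = (\<Sum>s<t. r ^ s)"
    using sum.nat_diff_reindex[of "\<lambda>s. r ^ s" t] by simp
  also have "\<dots> = (1 - r ^ t) / (1 - r)"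
    using assms by (simp add: sum_gp_strict)
  also have "\<dots> \<le> 1 / (1 - r)"
    using assms by (intro divide_right_mono) auto
  finally show ?thesis .
qed


section \<open>Square integrable random vectors\<close>

definition square_integrable :: "'w measure \<Rightarrow> ('w \<Rightarrow> 'b::euclidean_space) \<Rightarrow> bool" where
  "square_integrable M Y \<longleftrightarrow> Y \<in> borel_measurable M \<and> integrable M (\<lambda>w. (norm (Y w))\<^sup>2)"

definition l2norm :: "'w measure \<Rightarrow> ('w \<Rightarrow> 'b::euclidean_space) \<Rightarrow> real" where
  "l2norm M Y = sqrt (\<integral>w. (norm (Y w))\<^sup>2 \<partial>M)"

lemma l2norm_nonneg: "0 \<le> l2norm M Y"
  unfolding l2norm_def by simp

lemma l2norm_power2: "(l2norm M Y)\<^sup>2 = (\<integral>w. (norm (Y w))\<^sup>2 \<partial>M)"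
  unfolding l2norm_def by simp

lemma l2norm_cong: "(\<And>w. w \<in> space M \<Longrightarrow> Y w = Y' w) \<Longrightarrow> l2norm M Y = l2norm M Y'"
  unfolding l2norm_def by (simp cong: Bochner_Integration.integral_cong)

lemma square_integrable_cong:
  "(\<And>w. w \<in> space M \<Longrightarrow> Y w = Y' w) \<Longrightarrow> square_integrable M Y = square_integrable M Y'"
  unfolding square_integrable_def
  by (intro conj_cong measurable_cong Bochner_Integration.integrable_cong) auto

lemma square_integrable_measurable: "square_integrable M Y \<Longrightarrow> Y \<in> borel_measurable M"
  and square_integrable_power2: "square_integrable M Y \<Longrightarrow> integrable M (\<lambda>w. (norm (Y w))\<^sup>2)"
  unfolding square_integrable_def by simp_all

lemma square_integrable_zero: "square_integrable M (\<lambda>w. 0)"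
  unfolding square_integrable_def by simp

lemma square_integrable_bound:
  assumes "square_integrable M Y" "Z \<in> borel_measurable M"
    and "\<And>w. w \<in> space M \<Longrightarrow> norm (Z w) \<le> K * norm (Y w)"
  shows "square_integrable M Z"
proof -
  have "integrable M (\<lambda>w. K\<^sup>2 * (norm (Y w))\<^sup>2)"
    using assms(1) by (simp add: square_integrable_power2)
  moreover have "(\<lambda>w. (norm (Z w))\<^sup>2) \<in> borel_measurable M"
    using assms(2) by measurable
  moreover have "AE w in M. norm ((norm (Z w))\<^sup>2) \<le> norm (K\<^sup>2 * (norm (Y w))\<^sup>2)"
  proof (rule AE_I2)
    fix w assume "w \<in> space M"
    then have "(norm (Z w))\<^sup>2 \<le> (K * norm (Y w))\<^sup>2"
      using assms(3) by (intro power_mono) auto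
    then show "norm ((norm (Z w))\<^sup>2) \<le> norm (K\<^sup>2 * (norm (Y w))\<^sup>2)"
      by (simp add: power_mult_distrib)
  qed
  ultimately have "integrable M (\<lambda>w. (norm (Z w))\<^sup>2)"
    by (rule Bochner_Integration.integrable_bound)
  with assms(2) show ?thesis
    unfolding square_integrable_def by simp
qed

lemma l2norm_bound:
  assumes "square_integrable M Y" "Z \<in> borel_measurable M"
    and "\<And>w. w \<in> space M \<Longrightarrow> norm (Z w) \<le> K * norm (Y w)" and "0 \<le> K"
  shows "l2norm M Z \<le> K * l2norm M Y"
proof (rule power2_le_imp_le)
  have "(\<integral>w. (norm (Z w))\<^sup>2 \<partial>M) \<le> (\<integral>w. K\<^sup>2 * (norm (Y w))\<^sup>2 \<partial>M)"
  proof (rule integral_mono)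
    show "integrable M (\<lambda>w. (norm (Z w))\<^sup>2)"
      using square_integrable_bound[OF assms(1-3)] by (rule square_integrable_power2)
    fix w assume "w \<in> space M"
    then have "(norm (Z w))\<^sup>2 \<le> (K * norm (Y w))\<^sup>2"
      using assms(3) by (intro power_mono) auto
    then show "(norm (Z w))\<^sup>2 \<le> K\<^sup>2 * (norm (Y w))\<^sup>2"
      by (simp add: power_mult_distrib)
  qed (use assms(1) in \<open>simp add: square_integrable_power2\<close>)
  then show "(l2norm M Z)\<^sup>2 \<le> (K * l2norm M Y)\<^sup>2"
    by (simp add: power_mult_distrib l2norm_power2)
qed (use assms(4) in \<open>simp add: l2norm_nonneg\<close>)

lemma borel_measurable_linear:
  fixes f :: "'a::euclidean_space \<Rightarrow> 'b::euclidean_space"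
  assumes "Y \<in> borel_measurable M" "linear f"
  shows "(\<lambda>w. f (Y w)) \<in> borel_measurable M"
proof -
  have "f \<in> borel_measurable borel"
    using assms(2) by (intro borel_measurable_continuous_onI linear_continuous_on)
      (simp add: linear_conv_bounded_linear)
  with assms(1) show ?thesis
    by (rule measurable_compose)
qed

lemma square_integrable_linear:
  fixes f :: "'a::euclidean_space \<Rightarrow> 'b::euclidean_space"
  assumes "square_integrable M Y" "linear f"
  shows "square_integrable M (\<lambda>w. f (Y w))"
proof -
  have bl: "bounded_linear f"
    using assms(2) linear_conv_bounded_linear by blast
  have "(\<lambda>w. f (Y w)) \<in> borel_measurable M"
    using square_integrable_measurable[OF assms(1)] assms(2) by (rule borel_measurable_linear)
  then show ?thesis
    by (rule square_integrable_bound[OF assms(1)]) (rule onorm[OF bl])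
qed

lemma square_integrable_scaleR:
  "square_integrable M Y \<Longrightarrow> square_integrable M (\<lambda>w. c *\<^sub>R Y w)"
  by (rule square_integrable_linear[where f = "\<lambda>x. c *\<^sub>R x"]) (auto simp: linear_iff algebra_simps)

lemma square_integrable_inner:
  assumes "square_integrable M Y" "square_integrable M Z"
  shows "integrable M (\<lambda>w. Y w \<bullet> Z w)"
proof (rule Bochner_Integration.integrable_bound)
  show "integrable M (\<lambda>w. (norm (Y w))\<^sup>2 + (norm (Z w))\<^sup>2)"
    using assms by (simp add: square_integrable_power2)
  show "(\<lambda>w. Y w \<bullet> Z w) \<in> borel_measurable M"
    using assms by (intro borel_measurable_inner square_integrable_measurable)
  show "AE w in M. norm (Y w \<bullet> Z w) \<le> norm ((norm (Y w))\<^sup>2 + (norm (Z w))\<^sup>2)"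
  proof (rule AE_I2)
    fix w
    have "\<bar>Y w \<bullet> Z w\<bar> \<le> norm (Y w) * norm (Z w)"
      by (rule Cauchy_Schwarz_ineq2)
    also have "\<dots> \<le> (norm (Y w))\<^sup>2 + (norm (Z w))\<^sup>2"
      using sum_squares_bound[of "norm (Y w)" "norm (Z w)"]
        mult_nonneg_nonneg[OF norm_ge_zero[of "Y w"] norm_ge_zero[of "Z w"]]
      by linarith
    finally show "norm (Y w \<bullet> Z w) \<le> norm ((norm (Y w))\<^sup>2 + (norm (Z w))\<^sup>2)"
      by simp
  qed
qed

lemma norm_add_power2:
  fixes x y :: "'a::real_inner"
  shows "(norm (x + y))\<^sup>2 = (norm x)\<^sup>2 + 2 * (x \<bullet> y) + (norm y)\<^sup>2"
  by (simp add: power2_norm_eq_inner inner_add inner_commute)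

lemma square_integrable_add:
  assumes "square_integrable M Y" "square_integrable M Z"
  shows "square_integrable M (\<lambda>w. Y w + Z w)"
  unfolding square_integrable_def norm_add_power2
  using assms square_integrable_inner[OF assms]
  by (simp add: square_integrable_measurable square_integrable_power2 borel_measurable_add)

lemma square_integrable_diff:
  assumes "square_integrable M Y" "square_integrable M Z"
  shows "square_integrable M (\<lambda>w. Y w - Z w)"
  using square_integrable_add[OF assms(1) square_integrable_scaleR[OF assms(2), of "-1"]] by simp

lemma square_integrable_sum:
  assumes "\<And>i. i \<in> I \<Longrightarrow> square_integrable M (Y i)"
  shows "square_integrable M (\<lambda>w. \<Sum>i\<in>I. Y i w)"
  using assms
  by (induction I rule: infinite_finite_induct)
     (simp_all add: square_integrable_zero square_integrable_add)

lemma integral_norm_add_power2: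
  assumes "square_integrable M Y" "square_integrable M Z"
  shows "(\<integral>w. (norm (Y w + Z w))\<^sup>2 \<partial>M)
    = (\<integral>w. (norm (Y w))\<^sup>2 \<partial>M) + 2 * (\<integral>w. Y w \<bullet> Z w \<partial>M) + (\<integral>w. (norm (Z w))\<^sup>2 \<partial>M)"
  unfolding norm_add_power2
  using assms square_integrable_inner[OF assms] by (simp add: square_integrable_power2)

text \<open>The expectation of \<open>\<parallel>Y - c Z\<parallel>\<^sup>2\<close> is a nonnegative quadratic polynomial in \<open>c\<close>.\<close>

lemma integral_inner_le_l2norm:
  assumes Y: "square_integrable M Y" and Z: "square_integrable M Z"
  shows "(\<integral>w. Y w \<bullet> Z w \<partial>M) \<le> l2norm M Y * l2norm M Z"
proof -
  define a p b where "a = (\<integral>w. (norm (Y w))\<^sup>2 \<partial>M)" and "p = (\<integral>w. Y w \<bullet> Z w \<partial>M)"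
    and "b = (\<integral>w. (norm (Z w))\<^sup>2 \<partial>M)"
  have quad: "0 \<le> a - 2 * c * p + c\<^sup>2 * b" for c
  proof -
    have "0 \<le> (\<integral>w. (norm (Y w + (- c) *\<^sub>R Z w))\<^sup>2 \<partial>M)"
      by simp
    then show ?thesis
      unfolding integral_norm_add_power2[OF Y square_integrable_scaleR[OF Z]]
      by (simp add: a_def p_def b_def power_mult_distrib)
  qed
  have nn: "0 \<le> a" "0 \<le> b"
    unfolding a_def b_def by simp_all
  have "p\<^sup>2 \<le> a * b"
  proof (cases "b = 0")
    case True
    have "p = 0"
    proof (rule ccontr)
      assume "p \<noteq> 0"
      then show False
        using quad[of "(a + 1) / (2 * p)"] True by simp
    qed
    then show ?thesis
      using True by simp
  next
    case False
    then show ?thesis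
      using quad[of "p / b"] nn by (simp add: power2_eq_square field_simps)
  qed
  then have "p \<le> sqrt (a * b)"
    using real_le_rsqrt by blast
  then show ?thesis
    unfolding l2norm_def a_def p_def b_def by (simp add: real_sqrt_mult)
qed

lemma l2norm_triangle:
  assumes Y: "square_integrable M Y" and Z: "square_integrable M Z"
  shows "l2norm M (\<lambda>w. Y w + Z w) \<le> l2norm M Y + l2norm M Z"
proof (rule power2_le_imp_le)
  show "(l2norm M (\<lambda>w. Y w + Z w))\<^sup>2 \<le> (l2norm M Y + l2norm M Z)\<^sup>2"
    using integral_inner_le_l2norm[OF assms]
    by (simp add: l2norm_power2 integral_norm_add_power2[OF assms] power2_sum)
qed (simp add: l2norm_nonneg)

lemma l2norm_scaleR: "l2norm M (\<lambda>w. c *\<^sub>R Y w) = \<bar>c\<bar> * l2norm M Y"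
  unfolding l2norm_def by (simp add: power_mult_distrib real_sqrt_mult)

lemma l2norm_triangle_diff:
  assumes Y: "square_integrable M Y" and Z: "square_integrable M Z"
  shows "l2norm M (\<lambda>w. Y w - Z w) \<le> l2norm M Y + l2norm M Z"
  using l2norm_triangle[OF Y square_integrable_scaleR[OF Z, of "-1"]] l2norm_scaleR[of M "-1" Z]
  by simp

lemma l2norm_zero: "l2norm M (\<lambda>w. 0) = 0"
  unfolding l2norm_def by simp

lemma l2norm_sum:
  assumes "\<And>i. i \<in> I \<Longrightarrow> square_integrable M (Y i)"
  shows "l2norm M (\<lambda>w. \<Sum>i\<in>I. Y i w) \<le> (\<Sum>i\<in>I. l2norm M (Y i))"
  using assms
proof (induction I rule: infinite_finite_induct)
  case (insert i I)
  have "l2norm M (\<lambda>w. Y i w + (\<Sum>i\<in>I. Y i w)) \<le> l2norm M (Y i) + l2norm M (\<lambda>w. \<Sum>i\<in>I. Y i w)"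
    using insert by (intro l2norm_triangle square_integrable_sum) auto
  then show ?case
    using insert by fastforce
qed (simp_all add: l2norm_zero)

lemma square_integrable_const: "finite_measure M \<Longrightarrow> square_integrable M (\<lambda>w. c)"
  unfolding square_integrable_def by (simp add: finite_measure.integrable_const)

lemma vec_nth_linear: "linear (\<lambda>x :: 'a::real_vector^'n. x $ i)"
  by (simp add: linear_iff)

lemma square_integrable_vec:
  fixes Y :: "'w \<Rightarrow> 'a::euclidean_space^'n"
  assumes "Y \<in> borel_measurable M" "\<And>i. square_integrable M (\<lambda>w. Y w $ i)"
  shows "square_integrable M Y"
  using assms unfolding square_integrable_def norm_vec_power2 by simp

lemma l2norm_vec_power2:
  fixes Y :: "'w \<Rightarrow> 'a::euclidean_space^'n"
  assumes "\<And>i. square_integrable M (\<lambda>w. Y w $ i)"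
  shows "(l2norm M Y)\<^sup>2 = (\<Sum>i\<in>UNIV. (l2norm M (\<lambda>w. Y w $ i))\<^sup>2)"
  unfolding l2norm_power2 norm_vec_power2
  using assms by (simp add: square_integrable_power2)


section \<open>Integrating out an independent variable\<close>

text \<open>Independence, stated through the joint law so that samples, seeds and iterates, which have values
  in different types, can be compared.\<close>

definition (in prob_space) product_law ::
  "'b measure \<Rightarrow> ('a \<Rightarrow> 'b) \<Rightarrow> 'c measure \<Rightarrow> ('a \<Rightarrow> 'c) \<Rightarrow> bool" where
  "product_law N Y K V \<longleftrightarrow> Y \<in> measurable M N \<and> V \<in> measurable M K \<and>
    distr M (N \<Otimes>\<^sub>M K) (\<lambda>w. (Y w, V w)) = distr M N Y \<Otimes>\<^sub>M distr M K V"

lemma (in prob_space) product_law_measurable: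
  assumes "product_law N Y K V"
  shows "Y \<in> measurable M N" "V \<in> measurable M K"
  using assms unfolding product_law_def by auto

lemma (in prob_space) product_lawI:
  assumes [measurable]: "Y \<in> measurable M N" "V \<in> measurable M K"
    and ind: "\<And>A B. A \<in> sets N \<Longrightarrow> B \<in> sets K \<Longrightarrow>
      prob ((Y -` A \<inter> space M) \<inter> (V -` B \<inter> space M)) = prob (Y -` A \<inter> space M) * prob (V -` B \<inter> space M)"
  shows "product_law N Y K V"
proof -
  interpret Y: prob_space "distr M N Y"
    by (rule prob_space_distr) simp
  interpret V: prob_space "distr M K V"
    by (rule prob_space_distr) simp
  have "distr M N Y \<Otimes>\<^sub>M distr M K V = distr M (N \<Otimes>\<^sub>M K) (\<lambda>w. (Y w, V w))"
  proof (rule pair_measure_eqI)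
    show "sigma_finite_measure (distr M N Y)" "sigma_finite_measure (distr M K V)"
      by unfold_locales
    show "sets (distr M N Y \<Otimes>\<^sub>M distr M K V) = sets (distr M (N \<Otimes>\<^sub>M K) (\<lambda>w. (Y w, V w)))"
      by (simp cong: sets_pair_measure_cong)
    fix A B assume "A \<in> sets (distr M N Y)" "B \<in> sets (distr M K V)"
    then have [measurable]: "A \<in> sets N" "B \<in> sets K"
      by simp_all
    have "(\<lambda>w. (Y w, V w)) -` (A \<times> B) \<inter> space M = (Y -` A \<inter> space M) \<inter> (V -` B \<inter> space M)"
      by auto
    then show "emeasure (distr M N Y) A * emeasure (distr M K V) B
        = emeasure (distr M (N \<Otimes>\<^sub>M K) (\<lambda>w. (Y w, V w))) (A \<times> B)"
      using ind[of A B] by (simp add: emeasure_distr emeasure_eq_measure ennreal_mult)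
  qed
  then show ?thesis
    unfolding product_law_def by simp
qed

text \<open>Freezing: an independent argument can be integrated out first while the other is held
  fixed.\<close>

lemma (in prob_space) nn_integral_product_law:
  assumes ind: "product_law N Y K V" and law: "distr M K V = K"
    and h: "h \<in> borel_measurable (N \<Otimes>\<^sub>M K)"
  shows "(\<integral>\<^sup>+w. h (Y w, V w) \<partial>M) = (\<integral>\<^sup>+w. (\<integral>\<^sup>+v. h (Y w, v) \<partial>K) \<partial>M)"
proof -
  note [measurable] = product_law_measurable(1)[OF ind] product_law_measurable(2)[OF ind] h
  interpret K: prob_space K
    using prob_space_distr[OF product_law_measurable(2)[OF ind]] law by simp
  have "(\<integral>\<^sup>+w. h (Y w, V w) \<partial>M) = integral\<^sup>N (distr M (N \<Otimes>\<^sub>M K) (\<lambda>w. (Y w, V w))) h"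
    by (subst nn_integral_distr) measurable
  also have "\<dots> = integral\<^sup>N (distr M N Y \<Otimes>\<^sub>M K) h"
    using ind law unfolding product_law_def by simp
  also have "\<dots> = (\<integral>\<^sup>+y. (\<integral>\<^sup>+v. h (y, v) \<partial>K) \<partial>distr M N Y)"
    by (rule K.nn_integral_fst[symmetric]) measurable
  also have "\<dots> = (\<integral>\<^sup>+w. (\<integral>\<^sup>+v. h (Y w, v) \<partial>K) \<partial>M)"
    by (subst nn_integral_distr) measurable
  finally show ?thesis .
qed

lemma (in prob_space) integral_product_law:
  fixes h :: "_ \<Rightarrow> real"
  assumes ind: "product_law N Y K V" and law: "distr M K V = K"
    and h: "h \<in> borel_measurable (N \<Otimes>\<^sub>M K)" and int: "integrable M (\<lambda>w. h (Y w, V w))"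
  shows "(\<integral>w. h (Y w, V w) \<partial>M) = (\<integral>w. (\<integral>v. h (Y w, v) \<partial>K) \<partial>M)"
proof -
  note [measurable] = product_law_measurable(1)[OF ind] product_law_measurable(2)[OF ind] h
  interpret K: prob_space K
    using prob_space_distr[OF product_law_measurable(2)[OF ind]] law by simp
  interpret Y: prob_space "distr M N Y"
    by (rule prob_space_distr) simp
  interpret pair_sigma_finite "distr M N Y" K
    by unfold_locales
  have eq: "distr M (N \<Otimes>\<^sub>M K) (\<lambda>w. (Y w, V w)) = distr M N Y \<Otimes>\<^sub>M K"
    using ind law unfolding product_law_def by simp
  have "integrable (distr M (N \<Otimes>\<^sub>M K) (\<lambda>w. (Y w, V w))) h"
    using int by (subst integrable_distr_eq) measurable
  then have int': "integrable (distr M N Y \<Otimes>\<^sub>M K) h"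
    unfolding eq .
  have "(\<integral>w. h (Y w, V w) \<partial>M) = integral\<^sup>L (distr M (N \<Otimes>\<^sub>M K) (\<lambda>w. (Y w, V w))) h"
    by (subst integral_distr) measurable
  also have "\<dots> = (\<integral>y. (\<integral>v. h (y, v) \<partial>K) \<partial>distr M N Y)"
    unfolding eq by (rule integral_fst'[OF int', symmetric])
  also have "\<dots> = (\<integral>w. (\<integral>v. h (Y w, v) \<partial>K) \<partial>M)"
    by (subst integral_distr) measurable
  finally show ?thesis .
qed

text \<open>A moment bound that holds for every frozen value of \<open>Y\<close> survives averaging over \<open>Y\<close>.\<close>

lemma (in prob_space) square_integrable_product_law:
  fixes h :: "_ \<Rightarrow> 'b::euclidean_space"
  assumes ind: "product_law N Y K V" and law: "distr M K V = K"
    and h: "h \<in> borel_measurable (N \<Otimes>\<^sub>M K)"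
    and bound: "\<And>x. x \<in> space N \<Longrightarrow> integrable K (\<lambda>v. (norm (h (x, v)))\<^sup>2)
      \<and> (\<integral>v. (norm (h (x, v)))\<^sup>2 \<partial>K) \<le> c x"
    and c: "integrable M (\<lambda>w. c (Y w))"
  shows "square_integrable M (\<lambda>w. h (Y w, V w))"
    and "(l2norm M (\<lambda>w. h (Y w, V w)))\<^sup>2 \<le> (\<integral>w. c (Y w) \<partial>M)"
proof -
  note [measurable] = product_law_measurable(1)[OF ind] product_law_measurable(2)[OF ind] h
  have Y: "Y w \<in> space N" if "w \<in> space M" for w
    using that measurable_space[OF product_law_measurable(1)[OF ind]] by blast
  have c0: "0 \<le> c (Y w)" if "w \<in> space M" for w
  proof -
    have "0 \<le> (\<integral>v. (norm (h (Y w, v)))\<^sup>2 \<partial>K)"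
      by simp
    then show ?thesis
      using bound[OF Y[OF that]] by linarith
  qed
  have "(\<integral>\<^sup>+w. ennreal ((norm (h (Y w, V w)))\<^sup>2) \<partial>M)
      = (\<integral>\<^sup>+w. (\<integral>\<^sup>+v. ennreal ((norm (h (Y w, v)))\<^sup>2) \<partial>K) \<partial>M)"
    by (rule nn_integral_product_law[OF ind law, where h = "\<lambda>p. ennreal ((norm (h p))\<^sup>2)"]) measurable
  also have "\<dots> \<le> (\<integral>\<^sup>+w. ennreal (c (Y w)) \<partial>M)"
  proof (rule nn_integral_mono)
    fix w assume "w \<in> space M"
    then show "(\<integral>\<^sup>+v. ennreal ((norm (h (Y w, v)))\<^sup>2) \<partial>K) \<le> ennreal (c (Y w))"
      using bound[OF Y] by (subst nn_integral_eq_integral) (auto intro: ennreal_leI)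
  qed
  also have "\<dots> = ennreal (\<integral>w. c (Y w) \<partial>M)"
    using c c0 by (intro nn_integral_eq_integral) auto
  finally have le: "(\<integral>\<^sup>+w. ennreal ((norm (h (Y w, V w)))\<^sup>2) \<partial>M) \<le> ennreal (\<integral>w. c (Y w) \<partial>M)" .
  have "integrable M (\<lambda>w. (norm (h (Y w, V w)))\<^sup>2)"
  proof (rule integrableI_bounded)
    show "(\<integral>\<^sup>+w. ennreal (norm ((norm (h (Y w, V w)))\<^sup>2)) \<partial>M) < \<infinity>"
      using le by (simp add: order.strict_trans1)
  qed measurable
  then show sq: "square_integrable M (\<lambda>w. h (Y w, V w))"
    unfolding square_integrable_def by simp
  have "ennreal (\<integral>w. (norm (h (Y w, V w)))\<^sup>2 \<partial>M) \<le> ennreal (\<integral>w. c (Y w) \<partial>M)"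
    using le sq by (subst nn_integral_eq_integral[symmetric]) (auto dest: square_integrable_power2)
  moreover have "0 \<le> (\<integral>w. c (Y w) \<partial>M)"
    using c0 by (intro Bochner_Integration.integral_nonneg) auto
  ultimately show "(l2norm M (\<lambda>w. h (Y w, V w)))\<^sup>2 \<le> (\<integral>w. c (Y w) \<partial>M)"
    unfolding l2norm_power2 by simp
qed

text \<open>For frozen \<open>Y\<close> and \<open>Z\<close> the inner product is linear in the noise, so it integrates to zero. The
  noise may depend on \<open>Y\<close>, which is why \<open>Y\<close> and \<open>Z\<close> must be independent of \<open>V\<close> jointly.\<close>

lemma (in prob_space) integral_inner_indep_centred:
  fixes h :: "_ \<Rightarrow> 'b::euclidean_space" and Z :: "_ \<Rightarrow> 'b"
  assumes ind: "product_law (N \<Otimes>\<^sub>M borel) (\<lambda>w. (Y w, Z w)) K V" and law: "distr M K V = K"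
    and h: "h \<in> borel_measurable (N \<Otimes>\<^sub>M K)"
    and centred: "\<And>x. x \<in> space N \<Longrightarrow> has_bochner_integral K (\<lambda>v. h (x, v)) 0"
    and sq: "square_integrable M (\<lambda>w. h (Y w, V w))" "square_integrable M Z"
  shows "(\<integral>w. h (Y w, V w) \<bullet> Z w \<partial>M) = 0"
proof -
  have "(\<integral>w. h (Y w, V w) \<bullet> Z w \<partial>M)
      = (\<integral>w. (\<lambda>p. h (fst (fst p), snd p) \<bullet> snd (fst p)) ((Y w, Z w), V w) \<partial>M)"
    by simp
  also have "\<dots> = (\<integral>w. (\<integral>v. (\<lambda>p. h (fst (fst p), snd p) \<bullet> snd (fst p)) ((Y w, Z w), v) \<partial>K) \<partial>M)"
  proof (rule integral_product_law[OF ind law])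
    note [measurable] = h
    show "(\<lambda>p. h (fst (fst p), snd p) \<bullet> snd (fst p)) \<in> borel_measurable ((N \<Otimes>\<^sub>M borel) \<Otimes>\<^sub>M K)"
      by measurable
    show "integrable M (\<lambda>w. (\<lambda>p. h (fst (fst p), snd p) \<bullet> snd (fst p)) ((Y w, Z w), V w))"
      using square_integrable_inner[OF sq] by simp
  qed
  also have "\<dots> = (\<integral>w. 0 \<partial>M)"
  proof (rule Bochner_Integration.integral_cong)
    fix w assume "w \<in> space M"
    then have "Y w \<in> space N"
      using measurable_space[OF product_law_measurable(1)[OF ind]] by (auto simp: space_pair_measure)
    then have "has_bochner_integral K (\<lambda>v. h (Y w, v) \<bullet> Z w) (0 \<bullet> Z w)"
      by (intro has_bochner_integral_inner_left centred)
    then show "(\<integral>v. (\<lambda>p. h (fst (fst p), snd p) \<bullet> snd (fst p)) ((Y w, Z w), v) \<partial>K) = 0"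
      by (simp add: has_bochner_integral_integral_eq)
  qed simp
  finally show ?thesis
    by simp
qed


section \<open>Events generated by samples and seeds\<close>

context push_sum_randomness
begin

text \<open>\<open>Inl (i, t)\<close> stands for the gradient sample of agent \<open>i\<close> at time \<open>t\<close>, and \<open>Inr (i, t)\<close> for its
  compression seed.\<close>

abbreviation draws :: "('n \<times> nat + 'n \<times> nat) set" where
  "draws \<equiv> (UNIV \<times> {1..}) <+> UNIV"

definition draw_events :: "'n \<times> nat + 'n \<times> nat \<Rightarrow> 'w set set" where
  "draw_events = case_sum (\<lambda>(i, t). {\<xi> i t -` A \<inter> space M | A. A \<in> sets (D i)})
                          (\<lambda>(i, t). {\<rho> i t -` A \<inter> space M | A. A \<in> sets R})"

text \<open>The information carried by a set of draws. A quantity is shown to be independent of a draw by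
  exhibiting a set without that draw from which the quantity can be computed.\<close>

definition history :: "('n \<times> nat + 'n \<times> nat) set \<Rightarrow> 'w measure" where
  "history I = sigma (space M) (\<Union>k\<in>I. draw_events k)"

lemma indep_draw_events: "indep_sets draw_events draws"
  using independent unfolding draw_events_def .

lemma draw_events_subset: "I \<subseteq> draws \<Longrightarrow> (\<Union>k\<in>I. draw_events k) \<subseteq> sets M"
  using indep_draw_events unfolding indep_sets_def by blast

lemma space_history [simp]: "space (history I) = space M"
  unfolding history_def by (rule space_measure_of_conv)

lemma sets_history: "I \<subseteq> draws \<Longrightarrow> sets (history I) = sigma_sets (space M) (\<Union>k\<in>I. draw_events k)"
  unfolding history_def using draw_events_subset sets.sets_into_space
  by (intro sets_measure_of) blast

lemma history_le: "I \<subseteq> draws \<Longrightarrow> sets (history I) \<subseteq> sets M"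
  unfolding sets_history by (intro sets.sigma_sets_subset draw_events_subset)

lemma measurable_history:
  assumes "I \<subseteq> draws" "Y \<in> measurable (history I) N"
  shows "Y \<in> measurable M N"
  using assms(2) history_le[OF assms(1)] unfolding measurable_def by auto

lemma measurable_history_mono:
  assumes "Y \<in> measurable (history I) N" "I \<subseteq> J" "J \<subseteq> draws"
  shows "Y \<in> measurable (history J) N"
proof -
  have "sets (history I) \<subseteq> sets (history J)"
    using assms(2,3) by (subst (1 2) sets_history) (auto intro!: sigma_sets_mono')
  then show ?thesis
    using assms(1) unfolding measurable_def by auto
qed

lemma sample_measurable_history:
  assumes "Inl (i, t) \<in> I" "I \<subseteq> draws"
  shows "\<xi> i t \<in> measurable (history I) (D i)"
proof (rule measurableI)
  fix w assume "w \<in> space (history I)"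
  then show "\<xi> i t w \<in> space (D i)"
    using assms measurable_space[OF sample_measurable] by auto
next
  fix A assume "A \<in> sets (D i)"
  then have "\<xi> i t -` A \<inter> space M \<in> draw_events (Inl (i, t))"
    unfolding draw_events_def by auto
  then show "\<xi> i t -` A \<inter> space (history I) \<in> sets (history I)"
    using assms by (auto simp: sets_history intro!: sigma_sets.Basic)
qed

lemma seed_measurable_history:
  assumes "Inr (i, t) \<in> I" "I \<subseteq> draws"
  shows "\<rho> i t \<in> measurable (history I) R"
proof (rule measurableI)
  fix w assume "w \<in> space (history I)"
  then show "\<rho> i t w \<in> space R"
    using assms measurable_space[OF seed_measurable] by auto
next
  fix A assume "A \<in> sets R"
  then have "\<rho> i t -` A \<inter> space M \<in> draw_events (Inr (i, t))"
    unfolding draw_events_def by auto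
  then show "\<rho> i t -` A \<inter> space (history I) \<in> sets (history I)"
    using assms by (auto simp: sets_history intro!: sigma_sets.Basic)
qed

lemma Int_stable_draw_events: "Int_stable (draw_events k)"
proof -
  have vimage: "Int_stable {f -` A \<inter> space M | A. A \<in> sets N}" for f :: "'w \<Rightarrow> 'c" and N
  proof (rule Int_stableI)
    fix a b
    assume "a \<in> {f -` A \<inter> space M | A. A \<in> sets N}" "b \<in> {f -` A \<inter> space M | A. A \<in> sets N}"
    then obtain A B where "A \<in> sets N" "B \<in> sets N" "a = f -` A \<inter> space M" "b = f -` B \<inter> space M"
      by blast
    then show "a \<inter> b \<in> {f -` A \<inter> space M | A. A \<in> sets N}"
      by (intro CollectI exI[of _ "A \<inter> B"]) auto
  qed
  show ?thesis
    unfolding draw_events_def by (cases k) (auto simp: vimage split: prod.split)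
qed

lemma product_law_history:
  assumes Y: "Y \<in> measurable (history I) N" and V: "V \<in> measurable (history J) K"
    and sub: "I \<subseteq> draws" "J \<subseteq> draws" and disj: "I \<inter> J = {}"
  shows "product_law N Y K V"
proof -
  have "indep_sets draw_events (\<Union>b\<in>UNIV. case_bool I J b)"
    using indep_draw_events by (rule indep_sets_mono_index[rotated]) (use sub in \<open>auto split: bool.splits\<close>)
  moreover have "disjoint_family_on (case_bool I J) UNIV"
    using disj by (auto simp: disjoint_family_on_def split: bool.split)
  ultimately have "indep_sets (\<lambda>b. sigma_sets (space M) (\<Union>k\<in>case_bool I J b. draw_events k)) UNIV"
    by (intro indep_sets_collect_sigma Int_stable_draw_events)
  then have ind: "indep_set (sets (history I)) (sets (history J))"
    unfolding indep_set_def
    by (rule indep_sets_mono_sets) (use sub in \<open>auto simp: sets_history split: bool.split\<close>)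
  show ?thesis
  proof (rule product_lawI)
    show "Y \<in> measurable M N" "V \<in> measurable M K"
      using measurable_history sub Y V by blast+
    fix A B assume "A \<in> sets N" "B \<in> sets K"
    then show "prob ((Y -` A \<inter> space M) \<inter> (V -` B \<inter> space M))
        = prob (Y -` A \<inter> space M) * prob (V -` B \<inter> space M)"
      using measurable_sets[OF Y] measurable_sets[OF V] by (intro indep_setD[OF ind]) auto
  qed
qed

lemma product_law_sample:
  assumes "Y \<in> measurable (history I) N" "I \<subseteq> draws" "Inl (i, t) \<notin> I" "1 \<le> t"
  shows "product_law N Y (D i) (\<xi> i t)"
  using assms by (intro product_law_history[OF assms(1) sample_measurable_history[of i t "{Inl (i, t)}"]]) auto

lemma product_law_seed:
  assumes "Y \<in> measurable (history I) N" "I \<subseteq> draws" "Inr (i, t) \<notin> I"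
  shows "product_law N Y R (\<rho> i t)"
  using assms by (intro product_law_history[OF assms(1) seed_measurable_history[of i t "{Inr (i, t)}"]]) auto

end


section \<open>The compressed push-sum process\<close>

text \<open>The stepsize \<open>\<eta>\<close> is constrained but not tied to a horizon, so the estimates below hold at all
  times.\<close>

locale compressed_push_sum =
  mixing_matrix E W \<phi> \<delta> C \<kappa> +
  stochastic_losses D F +
  push_sum_randomness M D R \<xi> \<rho> +
  push_sum_iteration "space M" W F Q \<xi> \<rho> \<gamma> \<eta> X Xh U Z y
  for E :: "('n::finite \<times> 'n) set" and W \<phi> \<delta> C \<kappa>
    and D :: "'n \<Rightarrow> 's measure" and F :: "'n \<Rightarrow> real^'d \<Rightarrow> 's \<Rightarrow> real"
    and M :: "'w measure" and R :: "'r measure" and \<xi> \<rho> Q \<gamma> \<eta> X Xh U Z y +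
  fixes \<omega> \<sigma> G L :: real and x_star :: "real^'d"
  assumes omega: "0 < \<omega>" "\<omega> \<le> 1"
    and Q_measurable: "(\<lambda>(v, r). Q v r) \<in> borel_measurable (borel \<Otimes>\<^sub>M R)"
    and compression: "\<And>x. integrable R (\<lambda>r. (norm (Q x r - x))\<^sup>2) \<and>
      (\<integral>r. (norm (Q x r - x))\<^sup>2 \<partial>R) \<le> (1 - \<omega>) * (norm x)\<^sup>2"
    and bounded_variance: "\<And>i x.
      integrable (D i) (\<lambda>s. (norm (grad (\<lambda>u. F i u s) x - grad (local_loss D F i) x))\<^sup>2) \<and>
      (\<integral>s. (norm (grad (\<lambda>u. F i u s) x - grad (local_loss D F i) x))\<^sup>2 \<partial>D i) \<le> \<sigma>\<^sup>2"
    and bounded_gradients: "\<And>i x.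
      integrable (D i) (\<lambda>s. (norm (grad (\<lambda>u. F i u s) x))\<^sup>2) \<and>
      (\<integral>s. (norm (grad (\<lambda>u. F i u s) x))\<^sup>2 \<partial>D i) \<le> G\<^sup>2"
    and minimizer: "\<And>x. global_loss D F x_star \<le> global_loss D F x"
    and L_pos: "0 < L"
    and smooth: "\<And>i x x'.
      norm (grad (local_loss D F i) x - grad (local_loss D F i) x') \<le> L * norm (x - x')"
    and gamma_range: "0 < \<gamma>" "\<gamma> \<le> 1"
    and gamma: "\<gamma> = \<omega> * \<delta> / (12 * spectral_norm (W - mat 1) * (spectral_norm (W - mat 1) + 1) * (C + 1))"
    and eta_range: "0 < \<eta>" "\<eta> * L \<le> 1"
    and init_X: "\<And>w. w \<in> space M \<Longrightarrow> X 0 w = 0"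
    and init_Xh: "\<And>w. w \<in> space M \<Longrightarrow> Xh 0 w = 0"
    and init_y: "y 0 = 1"
begin

abbreviation "local_grad i \<equiv> grad (local_loss D F i)"

definition mean :: "nat \<Rightarrow> 'w \<Rightarrow> real^'d" where
  "mean t w = row_mean (X t w)"

definition sample_grad :: "nat \<Rightarrow> 'w \<Rightarrow> real^'d^'n" where
  "sample_grad t w = (\<chi> i. grad (\<lambda>u. F i u (\<xi> i t w)) (Z t w $ i))"

definition noise :: "nat \<Rightarrow> 'w \<Rightarrow> real^'d^'n" where
  "noise t w = (\<chi> i. sample_grad t w $ i - local_grad i (Z t w $ i))"

text \<open>The vector that is handed to the compressor at time \<open>t\<close>.\<close>

definition hat_error :: "nat \<Rightarrow> 'w \<Rightarrow> real^'d^'n" where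
  "hat_error t w = X t w - Xh t w"

text \<open>In terms of \<open>v = hat_error t w\<close> this is \<open>Q v - v\<close>, the quantity that the compression hypothesis
  bounds.\<close>

definition residual :: "nat \<Rightarrow> 'w \<Rightarrow> real^'d^'n" where
  "residual t w = Xh (Suc t) w - X t w"

lemma Xh_Suc: "w \<in> space M \<Longrightarrow> Xh (Suc t) w = Xh t w + (\<chi> i. Q (hat_error t w $ i) (\<rho> i t w))"
  using Xh_step[of w t] by (simp add: hat_error_def)

lemma U_Suc: "w \<in> space M \<Longrightarrow> U (Suc t) w = X t w + \<gamma> *\<^sub>R ((W - mat 1) ** Xh (Suc t) w)"
  using U_step[of w t] by simp

lemma Z_Suc: "w \<in> space M \<Longrightarrow> Z (Suc t) w = (\<chi> i. (1 / y (Suc t) $ i) *\<^sub>R (U (Suc t) w $ i))"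
  using Z_step[of w t] by (simp add: vec_eq_iff)

lemma X_Suc: "w \<in> space M \<Longrightarrow> X (Suc t) w = U (Suc t) w - \<eta> *\<^sub>R sample_grad (Suc t) w"
  using X_step[of w t] by (simp add: vec_eq_iff sample_grad_def)

lemma residual_nth:
  "w \<in> space M \<Longrightarrow> residual t w $ i = Q (hat_error t w $ i) (\<rho> i t w) - hat_error t w $ i"
  by (simp add: residual_def Xh_Suc hat_error_def)

lemma y_eq: "y t = mat_power W t *v 1"
proof (induction t)
  case 0
  then show ?case
    by (simp add: init_y)
next
  case (Suc t)
  then show ?case
    using y_step[of t] by (simp add: matrix_vector_mul_assoc)
qed

lemma y_ge: "\<kappa> \<le> y t $ i"
  unfolding y_eq by (rule mass_bound)

text \<open>The draws that determine \<open>X t\<close> and \<open>Xh t\<close>.\<close>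

definition past :: "nat \<Rightarrow> ('n \<times> nat + 'n \<times> nat) set" where
  "past t = (UNIV \<times> {1..t}) <+> (UNIV \<times> {..<t})"

text \<open>The draws that determine \<open>Z (Suc t)\<close>: the compression seeds of step \<open>t\<close> have been used, but not
  yet the gradient samples evaluated at \<open>Z (Suc t)\<close>.\<close>

definition mid_past :: "nat \<Rightarrow> ('n \<times> nat + 'n \<times> nat) set" where
  "mid_past t = (UNIV \<times> {1..t}) <+> (UNIV \<times> {..t})"

lemma past_subset_draws: "past t \<subseteq> draws"
  and mid_past_subset_draws: "mid_past t \<subseteq> draws"
  and past_subset_mid_past: "past t \<subseteq> mid_past t"
  and mid_past_subset_past: "mid_past t \<subseteq> past (Suc t)"
  and sample_in_past: "Inl (i, Suc t) \<in> past (Suc t)"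
  and sample_notin_mid_past: "Inl (i, Suc t) \<notin> mid_past t"
  and seed_in_mid_past: "Inr (i, t) \<in> mid_past t"
  and seed_notin_past: "Inr (i, t) \<notin> past t"
  by (auto simp: past_def mid_past_def)

lemma sample_grad_borel:
  "(\<lambda>(x, s). grad (\<lambda>u. F i u s) x) \<in> borel_measurable (borel \<Otimes>\<^sub>M D i)"
  using loss_integrable sample_differentiable
  by (intro borel_measurable_grad borel_measurable_integrable) auto

lemma measurable_space_cong:
  "(\<And>w. w \<in> space M \<Longrightarrow> Y w = Y' w) \<Longrightarrow> Y' \<in> borel_measurable (history I)
    \<Longrightarrow> Y \<in> borel_measurable (history I)"
  by (subst measurable_cong[of "history I" Y Y']) auto

lemma half_step_measurable:
  assumes X: "X t \<in> borel_measurable (history (past t))"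
    and Xh: "Xh t \<in> borel_measurable (history (past t))"
  shows "Xh (Suc t) \<in> borel_measurable (history (mid_past t))"
    and "U (Suc t) \<in> borel_measurable (history (mid_past t))"
    and "Z (Suc t) \<in> borel_measurable (history (mid_past t))"
proof -
  note mono = measurable_history_mono[OF _ past_subset_mid_past mid_past_subset_draws]
  have X': "X t \<in> borel_measurable (history (mid_past t))"
    and Xh': "Xh t \<in> borel_measurable (history (mid_past t))"
    using mono X Xh by blast+
  have "(\<lambda>w. hat_error t w $ i) \<in> borel_measurable (history (mid_past t))" for i
    unfolding hat_error_def using X' Xh'
    by (intro borel_measurable_linear[OF _ vec_nth_linear] borel_measurable_diff)
  then have "(\<lambda>w. (hat_error t w $ i, \<rho> i t w)) \<in> measurable (history (mid_past t)) (borel \<Otimes>\<^sub>M R)" for i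
    by (intro measurable_Pair seed_measurable_history seed_in_mid_past mid_past_subset_draws)
  from measurable_compose[OF this Q_measurable]
  have "(\<lambda>w. Q (hat_error t w $ i) (\<rho> i t w)) \<in> borel_measurable (history (mid_past t))" for i
    by simp
  then have "(\<lambda>w. Xh t w + (\<chi> i. Q (hat_error t w $ i) (\<rho> i t w)))
      \<in> borel_measurable (history (mid_past t))"
    using Xh' by (intro borel_measurable_add borel_measurable_vec_lambda)
  from measurable_space_cong[OF Xh_Suc this]
  show Xh_Suc': "Xh (Suc t) \<in> borel_measurable (history (mid_past t))" .
  have "linear (\<lambda>A :: real^'d^'n. \<gamma> *\<^sub>R ((W - mat 1) ** A))"
    by (simp add: linear_iff matrix_mult.add_right matrix_mult.scaleR_right scaleR_add_right)
  from borel_measurable_linear[OF Xh_Suc' this]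
  have "(\<lambda>w. X t w + \<gamma> *\<^sub>R ((W - mat 1) ** Xh (Suc t) w)) \<in> borel_measurable (history (mid_past t))"
    using X' by (intro borel_measurable_add)
  from measurable_space_cong[OF U_Suc this]
  show U_Suc': "U (Suc t) \<in> borel_measurable (history (mid_past t))" .
  have "(\<lambda>w. \<chi> i. (1 / y (Suc t) $ i) *\<^sub>R (U (Suc t) w $ i)) \<in> borel_measurable (history (mid_past t))"
    using borel_measurable_linear[OF U_Suc' vec_nth_linear]
    by (intro borel_measurable_vec_lambda borel_measurable_scaleR borel_measurable_const)
  from measurable_space_cong[OF Z_Suc this]
  show "Z (Suc t) \<in> borel_measurable (history (mid_past t))" .
qed

lemma sample_grad_measurable:
  assumes "Z (Suc t) \<in> borel_measurable (history (mid_past t))"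
  shows "sample_grad (Suc t) \<in> borel_measurable (history (past (Suc t)))"
proof -
  have "Z (Suc t) \<in> borel_measurable (history (past (Suc t)))"
    using measurable_history_mono[OF assms mid_past_subset_past past_subset_draws] .
  then have "(\<lambda>w. (Z (Suc t) w $ i, \<xi> i (Suc t) w))
      \<in> measurable (history (past (Suc t))) (borel \<Otimes>\<^sub>M D i)" for i
    by (intro measurable_Pair borel_measurable_linear[OF _ vec_nth_linear]
        sample_measurable_history sample_in_past past_subset_draws)
  from measurable_compose[OF this sample_grad_borel] show ?thesis
    unfolding sample_grad_def by (intro borel_measurable_vec_lambda) simp
qed

lemma iterates_measurable:
  shows X_measurable: "X t \<in> borel_measurable (history (past t))"
    and Xh_measurable: "Xh t \<in> borel_measurable (history (past t))"
proof (induction t)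
  case 0
  show "X 0 \<in> borel_measurable (history (past 0))"
    by (rule measurable_space_cong[where Y' = "\<lambda>w. 0"]) (simp_all add: init_X)
  show "Xh 0 \<in> borel_measurable (history (past 0))"
    by (rule measurable_space_cong[where Y' = "\<lambda>w. 0"]) (simp_all add: init_Xh)
next
  case (Suc t)
  note half = half_step_measurable[OF Suc]
  note mono = measurable_history_mono[OF _ mid_past_subset_past past_subset_draws]
  show "Xh (Suc t) \<in> borel_measurable (history (past (Suc t)))"
    using mono half(1) .
  have "(\<lambda>w. U (Suc t) w - \<eta> *\<^sub>R sample_grad (Suc t) w) \<in> borel_measurable (history (past (Suc t)))"
    using mono[OF half(2)] sample_grad_measurable[OF half(3)]
    by (intro borel_measurable_diff borel_measurable_scaleR borel_measurable_const)
  from measurable_space_cong[OF X_Suc this]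
  show "X (Suc t) \<in> borel_measurable (history (past (Suc t)))" .
qed

lemmas Z_measurable = half_step_measurable(3)[OF iterates_measurable]

text \<open>The input of the compressor is determined by the past, which does not contain the seeds used
  at time \<open>t\<close>.\<close>

lemma residual_moment:
  assumes sq: "square_integrable M (hat_error t)"
  shows "square_integrable M (residual t)"
    and "l2norm M (residual t) \<le> sqrt (1 - \<omega>) * l2norm M (hat_error t)"
proof -
  have err: "hat_error t \<in> borel_measurable (history (past t))"
    unfolding hat_error_def using X_measurable Xh_measurable by (rule borel_measurable_diff)
  have row: "square_integrable M (\<lambda>w. residual t w $ i) \<and>
      (l2norm M (\<lambda>w. residual t w $ i))\<^sup>2 \<le> (1 - \<omega>) * (l2norm M (\<lambda>w. hat_error t w $ i))\<^sup>2" for i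
  proof -
    let ?h = "\<lambda>(v, r). Q v r - v"
    have ind: "product_law borel (\<lambda>w. hat_error t w $ i) R (\<rho> i t)"
      by (intro product_law_seed[of _ "past t"] borel_measurable_linear[OF err vec_nth_linear]
          past_subset_draws seed_notin_past)
    have h: "?h \<in> borel_measurable (borel \<Otimes>\<^sub>M R)"
      using borel_measurable_diff[OF Q_measurable measurable_fst] by (simp add: case_prod_beta)
    have sqi: "square_integrable M (\<lambda>w. hat_error t w $ i)"
      using sq vec_nth_linear by (rule square_integrable_linear)
    then have c: "integrable M (\<lambda>w. (1 - \<omega>) * (norm (hat_error t w $ i))\<^sup>2)"
      by (simp add: square_integrable_power2)
    have bound: "integrable R (\<lambda>r. (norm (?h (v, r)))\<^sup>2) \<and>
        (\<integral>r. (norm (?h (v, r)))\<^sup>2 \<partial>R) \<le> (1 - \<omega>) * (norm v)\<^sup>2" for v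
      using compression by simp
    have eq: "?h (hat_error t w $ i, \<rho> i t w) = residual t w $ i" if "w \<in> space M" for w
      using that by (simp add: residual_nth)
    have "square_integrable M (\<lambda>w. ?h (hat_error t w $ i, \<rho> i t w))
        = square_integrable M (\<lambda>w. residual t w $ i)"
      and "l2norm M (\<lambda>w. ?h (hat_error t w $ i, \<rho> i t w)) = l2norm M (\<lambda>w. residual t w $ i)"
      using eq by (auto intro!: square_integrable_cong l2norm_cong)
    with square_integrable_product_law[OF ind seed_law h bound c]
    have "square_integrable M (\<lambda>w. residual t w $ i)"
      and "(l2norm M (\<lambda>w. residual t w $ i))\<^sup>2 \<le> (\<integral>w. (1 - \<omega>) * (norm (hat_error t w $ i))\<^sup>2 \<partial>M)"
      by simp_all
    then show ?thesis
      by (simp add: l2norm_power2)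
  qed
  have "residual t \<in> borel_measurable M"
    unfolding residual_def
    using measurable_history[OF past_subset_draws X_measurable]
      measurable_history[OF past_subset_draws Xh_measurable]
    by (intro borel_measurable_diff)
  then show "square_integrable M (residual t)"
    by (rule square_integrable_vec) (use row in auto)
  show "l2norm M (residual t) \<le> sqrt (1 - \<omega>) * l2norm M (hat_error t)"
  proof (rule power2_le_imp_le)
    have "(l2norm M (residual t))\<^sup>2 = (\<Sum>i\<in>UNIV. (l2norm M (\<lambda>w. residual t w $ i))\<^sup>2)"
      using row by (intro l2norm_vec_power2) auto
    also have "\<dots> \<le> (\<Sum>i\<in>UNIV. (1 - \<omega>) * (l2norm M (\<lambda>w. hat_error t w $ i))\<^sup>2)"
      using row by (intro sum_mono) auto
    also have "\<dots> = (1 - \<omega>) * (l2norm M (hat_error t))\<^sup>2"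
      using square_integrable_linear[OF sq vec_nth_linear]
      by (simp add: l2norm_vec_power2 sum_distrib_left)
    finally show "(l2norm M (residual t))\<^sup>2 \<le> (sqrt (1 - \<omega>) * l2norm M (hat_error t))\<^sup>2"
      using omega by (simp add: power_mult_distrib)
  qed (use omega in \<open>simp add: l2norm_nonneg\<close>)
qed

lemma product_law_row_sample:
  "product_law borel (\<lambda>w. Z (Suc t) w $ i) (D i) (\<xi> i (Suc t))"
  by (intro product_law_sample[of _ "mid_past t"] borel_measurable_linear[OF Z_measurable vec_nth_linear]
      mid_past_subset_draws sample_notin_mid_past) simp

lemma sample_grad_row_moment:
  shows "square_integrable M (\<lambda>w. sample_grad (Suc t) w $ i)"
    and "(l2norm M (\<lambda>w. sample_grad (Suc t) w $ i))\<^sup>2 \<le> G\<^sup>2"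
proof -
  let ?h = "\<lambda>(x, s). grad (\<lambda>u. F i u s) x"
  have "integrable (D i) (\<lambda>s. (norm (?h (x, s)))\<^sup>2) \<and> (\<integral>s. (norm (?h (x, s)))\<^sup>2 \<partial>D i) \<le> G\<^sup>2" for x
    using bounded_gradients by simp
  note * = square_integrable_product_law[OF product_law_row_sample sample_law sample_grad_borel this]
  show "square_integrable M (\<lambda>w. sample_grad (Suc t) w $ i)"
    and "(l2norm M (\<lambda>w. sample_grad (Suc t) w $ i))\<^sup>2 \<le> G\<^sup>2"
    using *[of t] prob_space by (simp_all add: sample_grad_def)
qed

lemma sample_grad_moment:
  shows "square_integrable M (sample_grad (Suc t))"
    and "l2norm M (sample_grad (Suc t)) \<le> sqrt (real CARD('n)) * \<bar>G\<bar>"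
proof -
  show "square_integrable M (sample_grad (Suc t))"
    by (intro square_integrable_vec sample_grad_row_moment
        measurable_history[OF past_subset_draws sample_grad_measurable[OF Z_measurable]])
  show "l2norm M (sample_grad (Suc t)) \<le> sqrt (real CARD('n)) * \<bar>G\<bar>"
  proof (rule power2_le_imp_le)
    have "(l2norm M (sample_grad (Suc t)))\<^sup>2 \<le> (\<Sum>i\<in>(UNIV :: 'n set). G\<^sup>2)"
      unfolding l2norm_vec_power2[OF sample_grad_row_moment(1)]
      by (intro sum_mono sample_grad_row_moment)
    then show "(l2norm M (sample_grad (Suc t)))\<^sup>2 \<le> (sqrt (real CARD('n)) * \<bar>G\<bar>)\<^sup>2"
      by (simp add: power_mult_distrib)
  qed simp
qed

lemma continuous_if_lipschitz_bound:
  fixes g :: "real^'d \<Rightarrow> 'b::real_normed_vector"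
  assumes "\<And>x x'. norm (g x - g x') \<le> L * norm (x - x')"
  shows "continuous_on UNIV g"
proof -
  have "L-lipschitz_on UNIV g"
    using assms L_pos by (intro lipschitz_onI) (auto simp: dist_norm)
  then show ?thesis
    by (rule lipschitz_on_continuous_on)
qed

lemma local_grad_continuous: "continuous_on UNIV (local_grad i)"
  by (intro continuous_if_lipschitz_bound smooth)

lemma noise_borel:
  "(\<lambda>(x, s). grad (\<lambda>u. F i u s) x - local_grad i x) \<in> borel_measurable (borel \<Otimes>\<^sub>M D i)"
proof -
  have "(\<lambda>p. local_grad i (fst p)) \<in> borel_measurable (borel \<Otimes>\<^sub>M D i)"
    using measurable_fst borel_measurable_continuous_onI[OF local_grad_continuous]
    by (rule measurable_compose)
  from borel_measurable_diff[OF sample_grad_borel this] show ?thesis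
    by (simp add: case_prod_beta)
qed

lemma noise_centred:
  "has_bochner_integral (D i) (\<lambda>s. grad (\<lambda>u. F i u s) x - local_grad i x) 0"
proof -
  interpret Di: prob_space "D i"
    by (rule prob_D)
  have "has_bochner_integral (D i) (\<lambda>s. local_grad i x) (local_grad i x)"
    by (simp add: has_bochner_integral_iff Di.prob_space)
  from has_bochner_integral_diff[OF unbiased[of i x] this] show ?thesis
    by simp
qed

lemma noise_row_moment:
  shows "square_integrable M (\<lambda>w. noise (Suc t) w $ i)"
    and "(l2norm M (\<lambda>w. noise (Suc t) w $ i))\<^sup>2 \<le> \<sigma>\<^sup>2"
proof -
  let ?h = "\<lambda>(x, s). grad (\<lambda>u. F i u s) x - local_grad i x"
  have "integrable (D i) (\<lambda>s. (norm (?h (x, s)))\<^sup>2) \<and> (\<integral>s. (norm (?h (x, s)))\<^sup>2 \<partial>D i) \<le> \<sigma>\<^sup>2" for x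
    using bounded_variance by simp
  note * = square_integrable_product_law[OF product_law_row_sample sample_law noise_borel this]
  show "square_integrable M (\<lambda>w. noise (Suc t) w $ i)"
    and "(l2norm M (\<lambda>w. noise (Suc t) w $ i))\<^sup>2 \<le> \<sigma>\<^sup>2"
    using *[of t] prob_space by (simp_all add: noise_def sample_grad_def)
qed

text \<open>The noise of agent \<open>i\<close> depends on \<open>Z (Suc t)\<close> and on one fresh sample. Any \<open>V\<close> computed without
  that sample is orthogonal to it, in particular the noise of another agent at the same time.\<close>

lemma noise_orthogonal:
  assumes V: "V \<in> borel_measurable (history I)" "square_integrable M V"
    and I: "mid_past t \<subseteq> I" "I \<subseteq> draws" "Inl (i, Suc t) \<notin> I"
  shows "(\<integral>w. noise (Suc t) w $ i \<bullet> V w \<partial>M) = 0"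
proof -
  have "(\<lambda>w. (Z (Suc t) w $ i, V w)) \<in> measurable (history I) (borel \<Otimes>\<^sub>M borel)"
    using measurable_history_mono[OF Z_measurable I(1,2)] V(1)
    by (intro measurable_Pair borel_measurable_linear[OF _ vec_nth_linear])
  then have ind: "product_law (borel \<Otimes>\<^sub>M borel) (\<lambda>w. (Z (Suc t) w $ i, V w)) (D i) (\<xi> i (Suc t))"
    using I by (intro product_law_sample) auto
  have eq: "(\<lambda>(x, s). grad (\<lambda>u. F i u s) x - local_grad i x) (Z (Suc t) w $ i, \<xi> i (Suc t) w)
      = noise (Suc t) w $ i" for w
    by (simp add: noise_def sample_grad_def)
  show ?thesis
    using integral_inner_indep_centred[OF ind sample_law noise_borel _ _ V(2)]
      noise_centred noise_row_moment(1)
    unfolding eq by (simp add: noise_def sample_grad_def)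
qed

end


section \<open>Consensus error\<close>

text \<open>The compression error \<open>h\<close> is contracted by \<open>q\<close> and fed by the consensus error \<open>e\<close>, which is
  itself a discounted sum of past values of \<open>h\<close>. The smallness of \<open>b\<close> keeps the feedback loop
  below the gain \<open>\<omega> / 2\<close> of the contraction.\<close>

lemma coupled_errors_bounded:
  fixes h e :: "nat \<Rightarrow> real" and b c C r q \<omega> :: real
  defines "H \<equiv> 3 * c * (1 + C * b / r) / \<omega>"
  assumes par: "0 < \<omega>" "0 < r" "r \<le> 1" "0 \<le> C" "0 \<le> b" "0 \<le> c" "0 \<le> q" "q \<le> 1 - \<omega> / 2"
    and small: "b * (1 + C * b / r) \<le> \<omega> / 12"
    and h0: "h 0 = 0"
    and e: "\<And>t. e t \<le> (\<Sum>s<t. C * (1 - r) ^ (t - 1 - s) * (b * h s + c))"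
    and h: "\<And>t. h (Suc t) \<le> b * e t + (1 + b) * (q * h t) + c"
  shows "e t \<le> C / r * (b * H + c)"
proof -
  have H0: "0 \<le> H"
    unfolding H_def using par by simp
  have e_le: "e t \<le> C / r * (b * H + c)" if "\<And>s. s < t \<Longrightarrow> h s \<le> H" for t
  proof -
    have "e t \<le> (\<Sum>s<t. C * (1 - r) ^ (t - 1 - s) * (b * H + c))"
      using par that by (intro order_trans[OF e] sum_mono mult_left_mono add_right_mono) auto
    also have "\<dots> = (\<Sum>s<t. (1 - r) ^ (t - 1 - s)) * (C * (b * H + c))"
      unfolding sum_distrib_right by (simp add: mult_ac)
    also have "\<dots> \<le> 1 / (1 - (1 - r)) * (C * (b * H + c))"
      using par H0 by (intro mult_right_mono geometric_sum_le) auto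
    finally show ?thesis
      by simp
  qed
  have "h t \<le> H" for t
  proof (induction t rule: less_induct)
    case (less t)
    show ?case
    proof (cases t)
      case 0
      then show ?thesis
        using h0 H0 by simp
    next
      case (Suc t')
      \<comment> \<open>The constant in \<open>H\<close> is chosen so that the source term takes up \<open>\<omega> / 3\<close> of the gain.\<close>
      have c_eq: "c * (1 + C * b / r) = \<omega> / 3 * H"
        unfolding H_def using par by simp
      have "h t \<le> b * e t' + (1 + b) * (q * h t') + c"
        using h Suc by simp
      also have "\<dots> \<le> b * (C / r * (b * H + c)) + (1 + b) * ((1 - \<omega> / 2) * H) + c"
      proof (intro add_mono mult_left_mono order_refl)
        show "e t' \<le> C / r * (b * H + c)"
          using less Suc by (intro e_le) auto
        have "q * h t' \<le> q * H"
          using less Suc par by (intro mult_left_mono) auto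
        also have "\<dots> \<le> (1 - \<omega> / 2) * H"
          using par H0 by (intro mult_right_mono)
        finally show "q * h t' \<le> (1 - \<omega> / 2) * H" .
      qed (use par in auto)
      also have "\<dots> = H * (1 - \<omega> / 2 + b * (1 + C * b / r) - b * (\<omega> / 2)) + c * (1 + C * b / r)"
        by (simp add: algebra_simps)
      also have "\<dots> \<le> H * (1 - \<omega> / 2 + \<omega> / 12 - 0) + \<omega> / 3 * H"
        using small par H0 unfolding c_eq
        by (intro add_right_mono mult_left_mono diff_mono add_left_mono) auto
      also have "\<dots> \<le> H"
        using par H0 by (simp add: algebra_simps)
      finally show ?thesis .
    qed
  qed
  then show ?thesis
    by (rule e_le)
qed

context compressed_push_sum
begin

abbreviation \<beta> :: real where "\<beta> \<equiv> spectral_norm (W - mat 1)"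

text \<open>The part of the iterates that mixing removes.\<close>

definition deviation :: "nat \<Rightarrow> 'w \<Rightarrow> real^'d^'n" where
  "deviation t w = X t w - limit_matrix ** X t w"

text \<open>The inhomogeneous term of the recursion of \<open>X\<close> with matrix \<open>lazy_mixing \<gamma>\<close>.\<close>

definition drive :: "nat \<Rightarrow> 'w \<Rightarrow> real^'d^'n" where
  "drive t w = \<gamma> *\<^sub>R ((W - mat 1) ** residual t w) - \<eta> *\<^sub>R sample_grad (Suc t) w"

text \<open>If \<open>W\<close> were the identity, the formula for \<open>\<gamma>\<close> would divide by zero and hence give \<open>\<gamma> = 0\<close>.\<close>

lemma beta_pos: "0 < \<beta>"
proof (rule ccontr)
  assume "\<not> 0 < \<beta>"
  then have "\<beta> = 0"
    using spectral_norm_nonneg[of "W - mat 1"] by linarith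
  then show False
    using gamma gamma_range by simp
qed

lemma lazy_mixing_mult: "lazy_mixing \<gamma> ** (A :: real^'d^'n) = A + \<gamma> *\<^sub>R ((W - mat 1) ** A)"
  by (simp add: lazy_mixing_def matrix_mult.add_left matrix_mult.scaleR_left)

lemma X_rec: "w \<in> space M \<Longrightarrow> X (Suc t) w = lazy_mixing \<gamma> ** X t w + drive t w"
  by (simp add: X_Suc U_Suc lazy_mixing_mult drive_def residual_def matrix_mult.diff_right
      scaleR_diff_right)

lemma X_unrolled:
  assumes "w \<in> space M"
  shows "X t w = (\<Sum>s<t. mat_power (lazy_mixing \<gamma>) (t - 1 - s) ** drive s w)"
proof (induction t)
  case 0
  then show ?case
    using assms by (simp add: init_X)
next
  case (Suc t)
  have "lazy_mixing \<gamma> ** (mat_power (lazy_mixing \<gamma>) (t - 1 - s) ** drive s w)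
      = mat_power (lazy_mixing \<gamma>) (t - s) ** drive s w" if "s < t" for s
  proof -
    have "t - s = Suc (t - 1 - s)"
      using that by simp
    then show ?thesis
      by (simp add: matrix_mul_assoc)
  qed
  then show ?case
    unfolding X_rec[OF assms] Suc matrix_mult.sum_right by simp
qed

lemma deviation_unrolled:
  assumes "w \<in> space M"
  shows "deviation t w
    = (\<Sum>s<t. (mat_power (lazy_mixing \<gamma>) (t - 1 - s) - limit_matrix) ** drive s w)"
  unfolding deviation_def X_unrolled[OF assms, of t]
  by (simp add: matrix_mult.sum_right matrix_mul_assoc limit_matrix_mat_power_lazy
      matrix_mult.diff_left sum_subtractf)

text \<open>The limit profile is a fixed point of \<open>W\<close>, so mixing moves only the deviation. This is how the
  consensus error, and not the size of \<open>X t\<close>, enters the compression error.\<close>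

lemma W_deviation: "(W - mat 1) ** X t w = (W - mat 1) ** deviation t w"
  unfolding deviation_def
  by (simp add: matrix_mult.diff_right matrix_mult.diff_left matrix_mul_assoc W_limit_matrix)

lemma hat_error_rec:
  "w \<in> space M \<Longrightarrow> hat_error (Suc t) w = \<gamma> *\<^sub>R ((W - mat 1) ** deviation t w)
    + (\<gamma> *\<^sub>R ((W - mat 1) ** residual t w) - residual t w) - \<eta> *\<^sub>R sample_grad (Suc t) w"
  unfolding W_deviation[symmetric]
  by (simp add: hat_error_def X_Suc U_Suc residual_def matrix_mult.diff_right algebra_simps)

lemma matrix_mult_linear: "linear (\<lambda>X. (A :: real^'n^'n) ** (X :: real^'d^'n))"
  by (simp add: linear_iff matrix_mult.add_right matrix_mult.scaleR_right)

lemma square_integrable_matrix_mult: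
  "square_integrable M Y \<Longrightarrow> square_integrable M (\<lambda>w. (A :: real^'n^'n) ** (Y w :: real^'d^'n))"
  using matrix_mult_linear by (rule square_integrable_linear[rotated])

lemma l2norm_matrix_mult:
  assumes "square_integrable M Y"
  shows "l2norm M (\<lambda>w. (A :: real^'n^'n) ** (Y w :: real^'d^'n)) \<le> spectral_norm A * l2norm M Y"
  by (rule l2norm_bound[OF assms])
     (simp_all add: norm_matrix_mult_le spectral_norm_nonneg
        square_integrable_measurable[OF square_integrable_matrix_mult[OF assms]])

lemma iterates_square_integrable:
  shows X_square_integrable: "square_integrable M (X t)"
    and Xh_square_integrable: "square_integrable M (Xh t)"
proof (induction t)
  case 0
  show "square_integrable M (X 0)" "square_integrable M (Xh 0)"
    using square_integrable_cong[of M "X 0" "\<lambda>w. 0"] square_integrable_cong[of M "Xh 0" "\<lambda>w. 0"]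
    by (simp_all add: init_X init_Xh square_integrable_zero)
next
  case (Suc t)
  have "square_integrable M (hat_error t)"
    unfolding hat_error_def using Suc by (rule square_integrable_diff)
  then have res: "square_integrable M (residual t)"
    by (rule residual_moment)
  have "square_integrable M (\<lambda>w. X t w + residual t w)"
    using Suc(1) res by (rule square_integrable_add)
  then show "square_integrable M (Xh (Suc t))"
    by (simp add: residual_def)
  have "square_integrable M (\<lambda>w. lazy_mixing \<gamma> ** X t w + drive t w)"
    unfolding drive_def
    by (intro square_integrable_add square_integrable_diff square_integrable_scaleR
        square_integrable_matrix_mult Suc res sample_grad_moment)
  then show "square_integrable M (X (Suc t))"
    using square_integrable_cong[of M "X (Suc t)" "\<lambda>w. lazy_mixing \<gamma> ** X t w + drive t w"]
    by (simp add: X_rec)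
qed

lemma hat_error_square_integrable: "square_integrable M (hat_error t)"
  unfolding hat_error_def
  by (intro square_integrable_diff iterates_square_integrable)

lemmas residual_square_integrable = residual_moment(1)[OF hat_error_square_integrable]
lemmas l2norm_residual = residual_moment(2)[OF hat_error_square_integrable]

lemma drive_square_integrable: "square_integrable M (drive t)"
  unfolding drive_def
  by (intro square_integrable_diff square_integrable_scaleR square_integrable_matrix_mult
      residual_square_integrable sample_grad_moment)

lemma deviation_square_integrable: "square_integrable M (deviation t)"
  unfolding deviation_def
  by (intro square_integrable_diff square_integrable_matrix_mult X_square_integrable)

text \<open>The norm in \<open>L\<^sup>2\<close> of one gradient step of all agents together is at most this.\<close>

definition grad_size :: real where
  "grad_size = \<eta> * (sqrt (real CARD('n)) * \<bar>G\<bar>)"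

lemma grad_size_nonneg: "0 \<le> grad_size"
  unfolding grad_size_def using eta_range by simp

lemma l2norm_scaled_sample_grad: "l2norm M (\<lambda>w. \<eta> *\<^sub>R sample_grad (Suc t) w) \<le> grad_size"
  unfolding grad_size_def l2norm_scaleR using eta_range sample_grad_moment(2)
  by (simp add: mult_left_mono)

lemma sqrt_omega_le: "sqrt (1 - \<omega>) \<le> 1 - \<omega> / 2"
proof (rule real_le_lsqrt)
  show "1 - \<omega> \<le> (1 - \<omega> / 2)\<^sup>2"
    by (simp add: power2_eq_square algebra_simps)
qed (use omega in auto)

lemma l2norm_mixed_residual:
  "l2norm M (\<lambda>w. \<gamma> *\<^sub>R ((W - mat 1) ** residual t w)) \<le> \<gamma> * \<beta> * l2norm M (residual t)"
  unfolding l2norm_scaleR using gamma_range l2norm_matrix_mult[OF residual_square_integrable]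
  by (simp add: mult.assoc)

lemma l2norm_drive: "l2norm M (drive t) \<le> \<gamma> * \<beta> * l2norm M (hat_error t) + grad_size"
proof -
  have "sqrt (1 - \<omega>) * l2norm M (hat_error t) \<le> 1 * l2norm M (hat_error t)"
    using omega by (intro mult_right_mono) (auto simp: l2norm_nonneg)
  then have "l2norm M (residual t) \<le> l2norm M (hat_error t)"
    using l2norm_residual[of t] by simp
  then have "\<gamma> * \<beta> * l2norm M (residual t) \<le> \<gamma> * \<beta> * l2norm M (hat_error t)"
    using gamma_range beta_pos by (intro mult_left_mono) auto
  moreover have "l2norm M (drive t) \<le> l2norm M (\<lambda>w. \<gamma> *\<^sub>R ((W - mat 1) ** residual t w))
      + l2norm M (\<lambda>w. \<eta> *\<^sub>R sample_grad (Suc t) w)"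
    unfolding drive_def
    by (intro l2norm_triangle_diff square_integrable_scaleR square_integrable_matrix_mult
        residual_square_integrable sample_grad_moment)
  ultimately show ?thesis
    using l2norm_mixed_residual[of t] l2norm_scaled_sample_grad[of t] by linarith
qed

lemma l2norm_deviation_le:
  "l2norm M (deviation t) \<le> (\<Sum>s<t. C * (1 - \<gamma> * \<delta>) ^ (t - 1 - s)
    * (\<gamma> * \<beta> * l2norm M (hat_error s) + grad_size))"
proof -
  have "l2norm M (deviation t)
      = l2norm M (\<lambda>w. \<Sum>s<t. (mat_power (lazy_mixing \<gamma>) (t - 1 - s) - limit_matrix) ** drive s w)"
    by (rule l2norm_cong) (rule deviation_unrolled)
  also have "\<dots> \<le> (\<Sum>s<t. l2norm M (\<lambda>w. (mat_power (lazy_mixing \<gamma>) (t - 1 - s) - limit_matrix) ** drive s w))"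
    by (intro l2norm_sum square_integrable_matrix_mult drive_square_integrable)
  also have "\<dots> \<le> (\<Sum>s<t. C * (1 - \<gamma> * \<delta>) ^ (t - 1 - s)
      * (\<gamma> * \<beta> * l2norm M (hat_error s) + grad_size))"
  proof (intro sum_mono order_trans[OF l2norm_matrix_mult[OF drive_square_integrable]] mult_mono)
    show "spectral_norm (mat_power (lazy_mixing \<gamma>) (t - 1 - s) - limit_matrix)
        \<le> C * (1 - \<gamma> * \<delta>) ^ (t - 1 - s)" for s
      using gamma_range by (intro spectral_norm_lazy_minus_limit) auto
    show "0 \<le> C * (1 - \<gamma> * \<delta>) ^ (t - 1 - s)" for s
      using C_pos gamma_range delta by (simp add: mult_le_one)
  qed (simp_all add: l2norm_drive l2norm_nonneg)
  finally show ?thesis .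
qed

lemma l2norm_hat_error_Suc:
  "l2norm M (hat_error (Suc t)) \<le> \<gamma> * \<beta> * l2norm M (deviation t)
    + (1 + \<gamma> * \<beta>) * (sqrt (1 - \<omega>) * l2norm M (hat_error t)) + grad_size"
proof -
  let ?D = "\<lambda>w. \<gamma> *\<^sub>R ((W - mat 1) ** deviation t w)"
  let ?R = "\<lambda>w. \<gamma> *\<^sub>R ((W - mat 1) ** residual t w)"
  let ?G = "\<lambda>w. \<eta> *\<^sub>R sample_grad (Suc t) w"
  have sq: "square_integrable M ?D" "square_integrable M ?R" "square_integrable M ?G"
    by (intro square_integrable_scaleR square_integrable_matrix_mult deviation_square_integrable
        residual_square_integrable sample_grad_moment)+
  have "l2norm M (hat_error (Suc t)) = l2norm M (\<lambda>w. ?D w + (?R w - residual t w) - ?G w)"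
    by (rule l2norm_cong) (rule hat_error_rec)
  also have "\<dots> \<le> l2norm M (\<lambda>w. ?D w + (?R w - residual t w)) + l2norm M ?G"
    by (intro l2norm_triangle_diff square_integrable_add square_integrable_diff sq residual_square_integrable)
  also have "\<dots> \<le> l2norm M ?D + l2norm M (\<lambda>w. ?R w - residual t w) + l2norm M ?G"
    by (intro add_right_mono l2norm_triangle square_integrable_diff sq residual_square_integrable)
  also have "\<dots> \<le> l2norm M ?D + (l2norm M ?R + l2norm M (residual t)) + l2norm M ?G"
    by (intro add_mono order_refl l2norm_triangle_diff sq residual_square_integrable)
  also have "\<dots> \<le> \<gamma> * \<beta> * l2norm M (deviation t)
      + (\<gamma> * \<beta> * l2norm M (residual t) + l2norm M (residual t)) + grad_size"
  proof (intro add_mono order_refl l2norm_mixed_residual l2norm_scaled_sample_grad)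
    show "l2norm M ?D \<le> \<gamma> * \<beta> * l2norm M (deviation t)"
      unfolding l2norm_scaleR using gamma_range l2norm_matrix_mult[OF deviation_square_integrable]
      by (simp add: mult.assoc)
  qed
  also have "\<dots> = \<gamma> * \<beta> * l2norm M (deviation t) + (1 + \<gamma> * \<beta>) * l2norm M (residual t) + grad_size"
    by (simp add: algebra_simps)
  also have "\<dots> \<le> \<gamma> * \<beta> * l2norm M (deviation t)
      + (1 + \<gamma> * \<beta>) * (sqrt (1 - \<omega>) * l2norm M (hat_error t)) + grad_size"
    using gamma_range beta_pos by (intro add_mono order_refl mult_left_mono l2norm_residual) auto
  finally show ?thesis .
qed

text \<open>One twelfth of \<open>C / (\<gamma> \<delta>)\<close>, the total weight of the discounted sum in \<open>l2norm_deviation_le\<close>.\<close>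

definition consensus_factor :: real where
  "consensus_factor = C * (C + 1) * \<beta> * (\<beta> + 1) / (\<omega> * \<delta>\<^sup>2)"

lemma consensus_factor_eq: "C / (\<gamma> * \<delta>) = 12 * consensus_factor"
  unfolding consensus_factor_def gamma
  using beta_pos C_pos delta omega by (simp add: field_simps power2_eq_square)

text \<open>By \<open>\<gamma> \<le> 1\<close> and \<open>\<delta> \<le> 1\<close>, the errors that are not amplified by \<open>1 / \<gamma>\<close> fit into the same scale.\<close>

lemma C_le_consensus_factor: "C \<le> 12 * consensus_factor" "C / \<delta> \<le> 12 * consensus_factor"
proof -
  have "\<gamma> * \<delta> \<le> \<delta>"
    using gamma_range delta by simp
  then show le: "C / \<delta> \<le> 12 * consensus_factor"
    unfolding consensus_factor_eq[symmetric]
    using gamma_range delta C_pos by (intro divide_left_mono) auto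
  have "C \<le> C / \<delta>"
    using C_pos delta by (simp add: field_simps)
  with le show "C \<le> 12 * consensus_factor"
    by simp
qed

lemma delta_C_beta_le: "\<delta> + C * \<beta> \<le> (C + 1) * (\<beta> + 1)"
  using delta C_pos beta_pos by (simp add: algebra_simps)

text \<open>The abstract bound gives \<open>C / (\<gamma> \<delta>)\<close> times the gradient size, that is \<open>12 * consensus_factor\<close>,
  plus a contribution of the compression error, for which \<open>3 * consensus_factor\<close> suffices.\<close>

lemma l2norm_deviation: "l2norm M (deviation t) \<le> 15 * consensus_factor * grad_size"
proof -
  let ?b = "\<gamma> * \<beta>" and ?r = "\<gamma> * \<delta>"
  have pos: "0 < ?b" "0 < ?r" "?r \<le> 1"
    using gamma_range delta beta_pos by (auto simp: mult_le_one)
  have loop: "1 + C * ?b / ?r = (\<delta> + C * \<beta>) / \<delta>"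
    using gamma_range delta by (simp add: field_simps)
  have "?b * (1 + C * ?b / ?r) = \<omega> / 12 * ((\<delta> + C * \<beta>) / ((C + 1) * (\<beta> + 1)))"
  proof -
    have "?b = \<omega> * \<delta> / (12 * (\<beta> + 1) * (C + 1))"
      unfolding gamma using beta_pos by simp
    then show ?thesis
      unfolding loop using delta by simp
  qed
  also have "\<dots> \<le> \<omega> / 12 * 1"
    using delta_C_beta_le C_pos beta_pos omega by (intro mult_left_mono) (auto simp: divide_le_eq)
  finally have small: "?b * (1 + C * ?b / ?r) \<le> \<omega> / 12"
    by simp
  have "l2norm M (deviation t)
      \<le> C / ?r * (?b * (3 * grad_size * (1 + C * ?b / ?r) / \<omega>) + grad_size)"
  proof (rule coupled_errors_bounded[where q = "sqrt (1 - \<omega>)" and h = "\<lambda>t. l2norm M (hat_error t)"])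
    have "l2norm M (hat_error 0) = l2norm M (\<lambda>w. 0 :: real^'d^'n)"
      by (rule l2norm_cong) (simp add: hat_error_def init_X init_Xh)
    then show "l2norm M (hat_error 0) = 0"
      by (simp add: l2norm_zero)
  qed (use omega pos C_pos grad_size_nonneg sqrt_omega_le small l2norm_deviation_le
      l2norm_hat_error_Suc in auto)
  also have "\<dots> = 3 * grad_size * (C / \<delta> * \<beta> * ((\<delta> + C * \<beta>) / \<delta>) / \<omega>) + C / ?r * grad_size"
    unfolding loop using gamma_range delta omega by (simp add: field_simps)
  also have "C / \<delta> * \<beta> * ((\<delta> + C * \<beta>) / \<delta>) / \<omega> = C * \<beta> * (\<delta> + C * \<beta>) / (\<omega> * \<delta>\<^sup>2)"
    by (simp add: power2_eq_square mult_ac)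
  also have "3 * grad_size * (C * \<beta> * (\<delta> + C * \<beta>) / (\<omega> * \<delta>\<^sup>2)) + C / ?r * grad_size
      \<le> 3 * grad_size * (C * \<beta> * ((C + 1) * (\<beta> + 1)) / (\<omega> * \<delta>\<^sup>2)) + C / ?r * grad_size"
    using delta_C_beta_le grad_size_nonneg C_pos beta_pos omega delta
    by (intro add_right_mono mult_left_mono divide_right_mono) auto
  also have "C * \<beta> * ((C + 1) * (\<beta> + 1)) / (\<omega> * \<delta>\<^sup>2) = consensus_factor"
    by (simp add: consensus_factor_def mult_ac)
  also have "3 * grad_size * consensus_factor + C / ?r * grad_size = 15 * consensus_factor * grad_size"
    unfolding consensus_factor_eq by simp
  finally show ?thesis .
qed

end


section \<open>Distance of the estimates to the average\<close>

lemma norm_row_mean_le: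
  fixes A :: "real^'d^'n"
  shows "norm (row_mean A) \<le> 1 / sqrt (real CARD('n)) * norm A"
  by (rule power2_le_imp_le)
     (use norm_row_mean_power2_le[of A] in \<open>simp_all add: power_divide\<close>)

lemma norm_ones: "norm (1 :: real^'n) = sqrt (real CARD('n))"
  by (simp add: norm_vec_def L2_set_def)

lemma norm_scaled_copies_le:
  fixes v :: "real^'n" and x :: "'a::real_normed_vector"
  shows "norm (\<chi> i. v $ i *\<^sub>R x) \<le> norm v * norm x"
  using norm_vec_le_scaled[of "\<chi> i. v $ i *\<^sub>R x" "norm x" v] by (simp add: mult.commute)

lemma square_integrable_row_mean:
  "square_integrable M Y \<Longrightarrow> square_integrable M (\<lambda>w. row_mean (Y w :: real^'d^'n))"
  using row_mean_linear by (rule square_integrable_linear[rotated])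

context compressed_push_sum
begin

lemma mean_square_integrable: "square_integrable M (mean t)"
  unfolding mean_def by (intro square_integrable_row_mean X_square_integrable)

lemma row_mean_U: "w \<in> space M \<Longrightarrow> row_mean (U (Suc t) w) = mean t w"
  by (simp add: U_Suc row_mean_add row_mean_scaleR row_mean_W mean_def)

lemma mean_Suc:
  "w \<in> space M \<Longrightarrow> mean (Suc t) w = mean t w - \<eta> *\<^sub>R row_mean (sample_grad (Suc t) w)"
  unfolding mean_def[of "Suc t"] by (simp add: X_Suc row_mean_diff row_mean_scaleR row_mean_U)

lemma mean_0: "w \<in> space M \<Longrightarrow> mean 0 w = 0"
  by (simp add: mean_def init_X row_mean_def)

lemma l2norm_mean_sample_grad: "l2norm M (\<lambda>w. row_mean (sample_grad (Suc t) w)) \<le> \<bar>G\<bar>"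
proof -
  have "l2norm M (\<lambda>w. row_mean (sample_grad (Suc t) w))
      \<le> 1 / sqrt (real CARD('n)) * l2norm M (sample_grad (Suc t))"
    using square_integrable_measurable[OF square_integrable_row_mean[OF sample_grad_moment(1)]]
    by (intro l2norm_bound sample_grad_moment norm_row_mean_le) auto
  also have "\<dots> \<le> 1 / sqrt (real CARD('n)) * (sqrt (real CARD('n)) * \<bar>G\<bar>)"
    by (intro mult_left_mono sample_grad_moment) simp
  finally show ?thesis
    by simp
qed

lemma l2norm_mean: "l2norm M (mean t) \<le> real t * (\<eta> * \<bar>G\<bar>)"
proof (induction t)
  case 0
  have "l2norm M (mean 0) = l2norm M (\<lambda>w. 0 :: real^'d)"
    by (rule l2norm_cong) (rule mean_0)
  then show ?case
    by (simp add: l2norm_zero)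
next
  case (Suc t)
  have "l2norm M (mean (Suc t)) = l2norm M (\<lambda>w. mean t w - \<eta> *\<^sub>R row_mean (sample_grad (Suc t) w))"
    by (rule l2norm_cong) (rule mean_Suc)
  also have "\<dots> \<le> l2norm M (mean t) + l2norm M (\<lambda>w. \<eta> *\<^sub>R row_mean (sample_grad (Suc t) w))"
    by (intro l2norm_triangle_diff mean_square_integrable square_integrable_scaleR
        square_integrable_row_mean sample_grad_moment)
  also have "\<dots> \<le> real t * (\<eta> * \<bar>G\<bar>) + \<eta> * \<bar>G\<bar>"
    unfolding l2norm_scaleR using eta_range l2norm_mean_sample_grad
    by (intro add_mono Suc) (simp add: mult_left_mono)
  finally show ?case
    by (simp add: algebra_simps)
qed

text \<open>The entries of \<open>limit_matrix *v 1\<close> are \<open>n \<phi>\<close>, the limit of the push-sum weights.\<close>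

definition weight_gap :: "nat \<Rightarrow> real^'n" where
  "weight_gap t = limit_matrix *v 1 - y t"

lemma limit_matrix_ones: "(limit_matrix *v 1) $ i = real CARD('n) * \<phi> $ i"
  by (simp add: limit_matrix_def matrix_vector_mult_def)

lemma norm_weight_gap: "norm (weight_gap t) \<le> C * (1 - \<delta>) ^ t * sqrt (real CARD('n))"
proof -
  have "norm (weight_gap t) = norm ((mat_power W t - limit_matrix) *v 1)"
    unfolding weight_gap_def y_eq by (simp add: matrix_vector_mult_diff_rdistrib norm_minus_commute)
  also have "\<dots> \<le> spectral_norm (mat_power W t - limit_matrix) * norm (1 :: real^'n)"
    by (rule norm_matrix_vector_le)
  also have "\<dots> \<le> C * (1 - \<delta>) ^ t * sqrt (real CARD('n))"
    unfolding norm_ones limit_matrix_def using mixing by (intro mult_right_mono) auto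
  finally show ?thesis .
qed

lemma weighted_mean_square_integrable:
  "square_integrable M (\<lambda>w. \<chi> i. weight_gap s $ i *\<^sub>R mean t w)"
  using mean_square_integrable
  by (rule square_integrable_linear) (simp add: linear_iff vec_eq_iff algebra_simps)

text \<open>The mean moves away from the origin at most linearly in time, while the gap of the weights decays
  geometrically.\<close>

lemma l2norm_weighted_mean:
  "l2norm M (\<lambda>w. \<chi> i. weight_gap (Suc t) $ i *\<^sub>R mean t w) \<le> C / \<delta> * grad_size"
proof -
  have "l2norm M (\<lambda>w. \<chi> i. weight_gap (Suc t) $ i *\<^sub>R mean t w)
      \<le> norm (weight_gap (Suc t)) * l2norm M (mean t)"
    using square_integrable_measurable[OF weighted_mean_square_integrable]
    by (intro l2norm_bound mean_square_integrable norm_scaled_copies_le) auto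
  also have "\<dots> \<le> (C * (1 - \<delta>) ^ Suc t * sqrt (real CARD('n))) * (real t * (\<eta> * \<bar>G\<bar>))"
    using C_pos delta by (intro mult_mono norm_weight_gap l2norm_mean) (auto simp: l2norm_nonneg)
  also have "\<dots> = C * grad_size * (real t * (1 - \<delta>) ^ Suc t)"
    by (simp add: grad_size_def mult_ac)
  also have "\<dots> \<le> C * grad_size * (1 / \<delta>)"
  proof (intro mult_left_mono)
    have "(1 - \<delta>) ^ Suc t \<le> (1 - \<delta>) ^ t"
      using delta by (intro power_decreasing) auto
    then have "real t * (1 - \<delta>) ^ Suc t \<le> real t * (1 - \<delta>) ^ t"
      by (intro mult_left_mono) auto
    also have "\<dots> \<le> 1 / \<delta>"
      using delta by (intro linear_times_geometric_le)
    finally show "real t * (1 - \<delta>) ^ Suc t \<le> 1 / \<delta>" .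
  qed (use C_pos grad_size_nonneg in simp)
  finally show ?thesis
    by simp
qed

definition disagreement :: "nat \<Rightarrow> 'w \<Rightarrow> real^'d^'n" where
  "disagreement t w = Z (Suc t) w - (\<chi> i. mean t w)"

text \<open>Multiplied by its weight, row \<open>i\<close> of the disagreement is \<open>U\<^sub>i - y\<^sub>i x\<close>, where \<open>x\<close> is the average.
  Inserting \<open>n \<phi>\<^sub>i x\<close> splits it into the deviation before the gradient step and the gap of the weights.
  The deviation before the gradient step differs from \<open>deviation (Suc t)\<close> by one gradient step, which
  explains the three summands 15, 12 and 12 of the constant 39.\<close>

lemma disagreement_moment:
  shows "square_integrable M (disagreement t)"
    and "l2norm M (disagreement t) \<le> 39 * consensus_factor * grad_size / \<kappa>"
proof -
  let ?S = "\<lambda>w. (mat 1 - limit_matrix) ** (\<eta> *\<^sub>R sample_grad (Suc t) w)"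
  let ?Y = "\<lambda>w. \<chi> i. weight_gap (Suc t) $ i *\<^sub>R mean t w"
  let ?V = "\<lambda>w. deviation (Suc t) w + ?S w + ?Y w"
  have sqS: "square_integrable M ?S"
    by (intro square_integrable_matrix_mult square_integrable_scaleR sample_grad_moment)
  have sq: "square_integrable M ?V"
    by (intro square_integrable_add deviation_square_integrable sqS weighted_mean_square_integrable)
  have meas: "disagreement t \<in> borel_measurable M"
    unfolding disagreement_def
    by (intro borel_measurable_diff borel_measurable_vec_lambda
        measurable_history[OF mid_past_subset_draws Z_measurable]
        square_integrable_measurable[OF mean_square_integrable])
  have bound: "norm (disagreement t w) \<le> 1 / \<kappa> * norm (?V w)" if w: "w \<in> space M" for w
  proof (rule norm_vec_le_scaled)
    fix i
    have "U (Suc t) w = X (Suc t) w + \<eta> *\<^sub>R sample_grad (Suc t) w"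
      by (simp add: X_Suc[OF w])
    then have "deviation (Suc t) w + ?S w = U (Suc t) w - limit_matrix ** U (Suc t) w"
      by (simp add: deviation_def matrix_mult.diff_left matrix_mult.add_right)
    then have V: "?V w $ i = U (Suc t) w $ i - y (Suc t) $ i *\<^sub>R mean t w"
      by (simp add: limit_matrix_mult_row row_mean_U[OF w] weight_gap_def limit_matrix_ones
          scaleR_diff_left)
    have y: "0 < y (Suc t) $ i"
      using y_ge[of "Suc t" i] kappa_pos by linarith
    have "disagreement t w $ i = (1 / y (Suc t) $ i) *\<^sub>R ?V w $ i"
      unfolding V using y by (simp add: disagreement_def Z_Suc[OF w] scaleR_diff_right)
    then have "norm (disagreement t w $ i) = 1 / y (Suc t) $ i * norm (?V w $ i)"
      using y by simp
    also have "\<dots> \<le> 1 / \<kappa> * norm (?V w $ i)"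
      using y_ge[of "Suc t" i] kappa_pos by (intro mult_right_mono divide_left_mono) auto
    finally show "norm (disagreement t w $ i) \<le> 1 / \<kappa> * norm (?V w $ i)" .
  qed (use kappa_pos in simp)
  show "square_integrable M (disagreement t)"
    using sq meas bound by (rule square_integrable_bound)
  have "l2norm M ?S \<le> spectral_norm (mat 1 - limit_matrix) * l2norm M (\<lambda>w. \<eta> *\<^sub>R sample_grad (Suc t) w)"
    by (intro l2norm_matrix_mult square_integrable_scaleR sample_grad_moment)
  also have "\<dots> \<le> C * grad_size"
    using spectral_norm_lazy_minus_limit[of \<gamma> 0] gamma_range C_pos
    by (intro mult_mono l2norm_scaled_sample_grad) (auto simp: l2norm_nonneg)
  finally have S: "l2norm M ?S \<le> C * grad_size" .
  have "l2norm M ?V \<le> l2norm M (\<lambda>w. deviation (Suc t) w + ?S w) + l2norm M ?Y"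
    by (intro l2norm_triangle square_integrable_add deviation_square_integrable sqS
        weighted_mean_square_integrable)
  also have "l2norm M (\<lambda>w. deviation (Suc t) w + ?S w) \<le> l2norm M (deviation (Suc t)) + l2norm M ?S"
    by (intro l2norm_triangle deviation_square_integrable sqS)
  also have "l2norm M (deviation (Suc t)) + l2norm M ?S + l2norm M ?Y
      \<le> 15 * consensus_factor * grad_size + C * grad_size + C / \<delta> * grad_size"
    by (intro add_mono l2norm_deviation S l2norm_weighted_mean)
  also have "\<dots> \<le> 15 * consensus_factor * grad_size + 12 * consensus_factor * grad_size
      + 12 * consensus_factor * grad_size"
    using grad_size_nonneg by (intro add_mono order_refl mult_right_mono C_le_consensus_factor)
  finally have V: "l2norm M ?V \<le> 39 * consensus_factor * grad_size"
    by (simp add: mult_ac)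
  have "l2norm M (disagreement t) \<le> 1 / \<kappa> * l2norm M ?V"
    using sq meas bound kappa_pos by (intro l2norm_bound) auto
  also have "\<dots> \<le> 1 / \<kappa> * (39 * consensus_factor * grad_size)"
    using V kappa_pos by (intro mult_left_mono) auto
  finally show "l2norm M (disagreement t) \<le> 39 * consensus_factor * grad_size / \<kappa>"
    by simp
qed


section \<open>Descent along the average\<close>

lemma global_GDERIV: "GDERIV (global_loss D F) x :> row_mean (\<chi> i. local_grad i x)"
proof -
  have "(local_loss D F i has_derivative (\<lambda>h. h \<bullet> local_grad i x)) (at x)" for i
    using GDERIV_grad[OF local_differentiable] unfolding gderiv_def .
  then have "((\<lambda>x. (1 / real CARD('n)) * (\<Sum>i\<in>UNIV. local_loss D F i x)) has_derivative
      (\<lambda>h. (1 / real CARD('n)) * (\<Sum>i\<in>UNIV. h \<bullet> local_grad i x))) (at x)"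
    by (intro has_derivative_mult_right has_derivative_sum)
  moreover have "global_loss D F = (\<lambda>x. (1 / real CARD('n)) * (\<Sum>i\<in>UNIV. local_loss D F i x))"
    by (simp add: fun_eq_iff global_loss_def)
  ultimately show ?thesis
    unfolding gderiv_def row_mean_def by (simp add: inner_sum_right)
qed

lemma global_differentiable: "global_loss D F differentiable (at x)"
  using global_GDERIV unfolding gderiv_def differentiable_def by blast

abbreviation "global_grad \<equiv> grad (global_loss D F)"

lemma global_grad_eq: "global_grad x = row_mean (\<chi> i. local_grad i x)"
  by (rule grad_eqI[OF global_GDERIV])

lemma norm_local_grads_diff_le:
  fixes Y Y' :: "real^'d^'n"
  shows "norm ((\<chi> i. local_grad i (Y $ i)) - (\<chi> i. local_grad i (Y' $ i))) \<le> L * norm (Y - Y')"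
  by (rule norm_vec_le_scaled) (use L_pos in \<open>simp_all add: smooth\<close>)

lemma norm_copies: "norm ((\<chi> i. x) :: real^'d^'n) = sqrt (real CARD('n)) * norm x"
proof (rule power2_eq_imp_eq)
  show "(norm ((\<chi> i. x) :: real^'d^'n))\<^sup>2 = (sqrt (real CARD('n)) * norm x)\<^sup>2"
    by (subst norm_vec_power2) (simp add: power_mult_distrib)
qed simp_all

lemma global_smooth: "norm (global_grad x - global_grad x') \<le> L * norm (x - x')"
proof -
  have copies: "((\<chi> i. x) - (\<chi> i. x') :: real^'d^'n) = (\<chi> i. x - x')"
    by (simp add: vec_eq_iff)
  have "norm (global_grad x - global_grad x')
      \<le> 1 / sqrt (real CARD('n)) * norm ((\<chi> i. local_grad i x) - (\<chi> i. local_grad i x'))"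
    unfolding global_grad_eq row_mean_diff[symmetric] by (rule norm_row_mean_le)
  also have "\<dots> \<le> 1 / sqrt (real CARD('n)) * (L * norm ((\<chi> i. x - x') :: real^'d^'n))"
    using norm_local_grads_diff_le[of "\<chi> i. x" "\<chi> i. x'"]
    unfolding copies by (intro mult_left_mono) simp_all
  also have "\<dots> = L * norm (x - x')"
    by (simp add: norm_copies)
  finally show ?thesis .
qed

lemma global_grad_borel: "global_grad \<in> borel_measurable borel"
  by (intro borel_measurable_continuous_onI continuous_if_lipschitz_bound global_smooth)

lemma mean_measurable: "mean t \<in> borel_measurable (history (mid_past t))"
  unfolding mean_def
  using measurable_history_mono[OF X_measurable past_subset_mid_past mid_past_subset_draws] row_mean_linear
  by (rule borel_measurable_linear)

lemma global_grad_mean_measurable: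
  "(\<lambda>w. global_grad (mean t w)) \<in> borel_measurable (history (mid_past t))"
  using mean_measurable global_grad_borel by (rule measurable_compose)

lemma global_grad_mean_square_integrable: "square_integrable M (\<lambda>w. global_grad (mean t w))"
proof -
  have "square_integrable M (\<lambda>w. global_grad (mean t w) - global_grad 0)"
  proof (rule square_integrable_bound[OF mean_square_integrable])
    show "(\<lambda>w. global_grad (mean t w) - global_grad 0) \<in> borel_measurable M"
      by (intro borel_measurable_diff borel_measurable_const
          measurable_history[OF mid_past_subset_draws global_grad_mean_measurable])
    show "norm (global_grad (mean t w) - global_grad 0) \<le> L * norm (mean t w)" for w
      using global_smooth[of "mean t w" 0] by simp
  qed
  from square_integrable_add[OF this square_integrable_const[OF finite_measure_axioms, of "global_grad 0"]]
  show ?thesis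
    by simp
qed

lemma global_descent:
  "global_loss D F (x + v) \<le> global_loss D F x + global_grad x \<bullet> v + L / 2 * (norm v)\<^sup>2"
  by (intro descent_inequality global_differentiable global_smooth)

text \<open>The loss is sandwiched between its minimum and the quadratic upper bound from smoothness.\<close>

lemma global_loss_mean_integrable: "integrable M (\<lambda>w. global_loss D F (mean t w))"
proof (rule Bochner_Integration.integrable_bound)
  let ?g = "\<lambda>w. \<bar>global_loss D F x_star\<bar> + \<bar>global_loss D F 0\<bar> + \<bar>global_grad 0 \<bullet> mean t w\<bar>
      + L / 2 * (norm (mean t w))\<^sup>2"
  show "integrable M ?g"
    using square_integrable_inner[OF square_integrable_const[OF finite_measure_axioms] mean_square_integrable]
      square_integrable_power2[OF mean_square_integrable]
    by (intro Bochner_Integration.integrable_add integrable_abs integrable_mult_right integrable_const)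
  have "continuous_on UNIV (global_loss D F)"
    using global_differentiable
    by (intro differentiable_imp_continuous_on) (simp add: differentiable_on_def)
  then show "(\<lambda>w. global_loss D F (mean t w)) \<in> borel_measurable M"
    by (intro measurable_compose[OF square_integrable_measurable[OF mean_square_integrable]]
        borel_measurable_continuous_onI)
  show "AE w in M. norm (global_loss D F (mean t w)) \<le> norm (?g w)"
  proof (rule AE_I2)
    fix w
    have "global_loss D F x_star \<le> global_loss D F (mean t w)"
      by (rule minimizer)
    moreover have "0 \<le> L / 2 * (norm (mean t w))\<^sup>2"
      using L_pos by simp
    ultimately show "norm (global_loss D F (mean t w)) \<le> norm (?g w)"
      using global_descent[of 0 "mean t w"] by simp
  qed
qed

definition true_grad :: "nat \<Rightarrow> 'w \<Rightarrow> real^'d^'n" where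
  "true_grad t w = (\<chi> i. local_grad i (Z t w $ i))"

lemma sample_grad_split: "sample_grad t w = true_grad t w + noise t w"
  by (simp add: vec_eq_iff true_grad_def noise_def)

lemma true_grad_measurable: "true_grad (Suc t) \<in> borel_measurable (history (mid_past t))"
  unfolding true_grad_def
  by (intro borel_measurable_vec_lambda measurable_compose[OF borel_measurable_linear[OF Z_measurable vec_nth_linear]]
      borel_measurable_continuous_onI local_grad_continuous)

lemma noise_measurable: "noise (Suc t) \<in> borel_measurable M"
proof -
  have "(\<lambda>w. sample_grad (Suc t) w - true_grad (Suc t) w) \<in> borel_measurable M"
    by (intro borel_measurable_diff square_integrable_measurable[OF sample_grad_moment(1)]
        measurable_history[OF mid_past_subset_draws true_grad_measurable])
  then show ?thesis
    by (simp add: sample_grad_split)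
qed

lemma noise_square_integrable: "square_integrable M (noise (Suc t))"
  by (intro square_integrable_vec noise_measurable noise_row_moment)

lemma true_grad_square_integrable: "square_integrable M (true_grad (Suc t))"
proof -
  have "square_integrable M (\<lambda>w. sample_grad (Suc t) w - noise (Suc t) w)"
    by (intro square_integrable_diff sample_grad_moment noise_square_integrable)
  then show ?thesis
    by (simp add: sample_grad_split)
qed

lemma integral_inner_mean_noise:
  assumes V: "V \<in> borel_measurable (history (mid_past t))" "square_integrable M V"
  shows "(\<integral>w. V w \<bullet> row_mean (noise (Suc t) w) \<partial>M) = 0"
proof -
  have int: "integrable M (\<lambda>w. V w \<bullet> noise (Suc t) w $ i)" for i
    using V(2) noise_row_moment(1) by (rule square_integrable_inner)
  have "(\<integral>w. V w \<bullet> noise (Suc t) w $ i \<partial>M) = 0" for i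
    using noise_orthogonal[OF V order_refl mid_past_subset_draws sample_notin_mid_past]
    by (simp add: inner_commute)
  then show ?thesis
    using int by (simp add: row_mean_def inner_sum_right)
qed

text \<open>All draws except one sample of agent \<open>i\<close> form a set large enough to compute the noise of every
  other agent.\<close>

lemma noise_row_measurable_history:
  assumes "i \<noteq> j"
  shows "(\<lambda>w. noise (Suc t) w $ j) \<in> borel_measurable (history (draws - {Inl (i, Suc t)}))"
proof -
  have sub: "mid_past t \<subseteq> draws - {Inl (i, Suc t)}"
    using mid_past_subset_draws sample_notin_mid_past by blast
  have "(\<lambda>w. (Z (Suc t) w $ j, \<xi> j (Suc t) w))
      \<in> measurable (history (draws - {Inl (i, Suc t)})) (borel \<Otimes>\<^sub>M D j)"
    using assms measurable_history_mono[OF Z_measurable sub]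
    by (intro measurable_Pair borel_measurable_linear[OF _ vec_nth_linear] sample_measurable_history) auto
  from measurable_compose[OF this noise_borel] show ?thesis
    by (simp add: noise_def sample_grad_def)
qed

text \<open>When agents are added one at a time, the new noise is orthogonal to the sum so far, so the second
  moments add up. This gives the factor \<open>1 / n\<close> in the variance of the mean.\<close>

lemma noise_sum_moment:
  "(l2norm M (\<lambda>w. \<Sum>i\<in>I. noise (Suc t) w $ i))\<^sup>2 \<le> real (card I) * \<sigma>\<^sup>2"
proof (induction I rule: infinite_finite_induct)
  case (insert i I)
  let ?V = "\<lambda>w. \<Sum>j\<in>I. noise (Suc t) w $ j"
  have sq: "square_integrable M ?V"
    by (intro square_integrable_sum noise_row_moment)
  have "?V \<in> borel_measurable (history (draws - {Inl (i, Suc t)}))"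
    using insert by (intro borel_measurable_sum noise_row_measurable_history) auto
  then have "(\<integral>w. noise (Suc t) w $ i \<bullet> ?V w \<partial>M) = 0"
    using sq mid_past_subset_draws sample_notin_mid_past by (intro noise_orthogonal) auto
  then have "(l2norm M (\<lambda>w. noise (Suc t) w $ i + ?V w))\<^sup>2
      = (l2norm M (\<lambda>w. noise (Suc t) w $ i))\<^sup>2 + (l2norm M ?V)\<^sup>2"
    unfolding l2norm_power2 integral_norm_add_power2[OF noise_row_moment(1) sq] by simp
  also have "\<dots> \<le> \<sigma>\<^sup>2 + real (card I) * \<sigma>\<^sup>2"
    by (intro add_mono noise_row_moment insert)
  finally show ?case
    using insert by (simp add: algebra_simps)
qed (simp_all add: l2norm_zero)

lemma mean_noise_moment:
  "(l2norm M (\<lambda>w. row_mean (noise (Suc t) w)))\<^sup>2 \<le> \<sigma>\<^sup>2 / real CARD('n)"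
proof -
  have "(l2norm M (\<lambda>w. row_mean (noise (Suc t) w)))\<^sup>2
      = (1 / real CARD('n))\<^sup>2 * (l2norm M (\<lambda>w. \<Sum>i\<in>UNIV. noise (Suc t) w $ i))\<^sup>2"
    unfolding row_mean_def l2norm_scaleR by (simp add: power_divide)
  also have "\<dots> \<le> (1 / real CARD('n))\<^sup>2 * (real CARD('n) * \<sigma>\<^sup>2)"
    by (intro mult_left_mono noise_sum_moment) simp
  also have "\<dots> = \<sigma>\<^sup>2 / real CARD('n)"
    by (simp add: power2_eq_square)
  finally show ?thesis .
qed

text \<open>The price for evaluating the gradients at the estimates of the agents instead of at the average.\<close>

lemma gradient_bias:
  "(l2norm M (\<lambda>w. global_grad (mean t w) - row_mean (true_grad (Suc t) w)))\<^sup>2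
    \<le> L\<^sup>2 / real CARD('n) * (l2norm M (disagreement t))\<^sup>2"
proof -
  have bound: "norm (global_grad (mean t w) - row_mean (true_grad (Suc t) w))
      \<le> L / sqrt (real CARD('n)) * norm (disagreement t w)" for w
  proof -
    have "norm (global_grad (mean t w) - row_mean (true_grad (Suc t) w))
        \<le> 1 / sqrt (real CARD('n)) * norm ((\<chi> i. local_grad i (mean t w)) - true_grad (Suc t) w)"
      unfolding global_grad_eq row_mean_diff[symmetric] by (rule norm_row_mean_le)
    also have "\<dots> \<le> 1 / sqrt (real CARD('n)) * (L * norm ((\<chi> i. mean t w) - Z (Suc t) w))"
      using norm_local_grads_diff_le[of "\<chi> i. mean t w" "Z (Suc t) w"]
      by (intro mult_left_mono) (simp_all add: true_grad_def)
    finally show ?thesis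
      by (simp add: disagreement_def norm_minus_commute)
  qed
  have "(l2norm M (\<lambda>w. global_grad (mean t w) - row_mean (true_grad (Suc t) w)))\<^sup>2
      \<le> (L / sqrt (real CARD('n)) * l2norm M (disagreement t))\<^sup>2"
  proof (intro power_mono l2norm_bound disagreement_moment bound l2norm_nonneg)
    show "(\<lambda>w. global_grad (mean t w) - row_mean (true_grad (Suc t) w)) \<in> borel_measurable M"
      by (intro borel_measurable_diff square_integrable_measurable global_grad_mean_square_integrable
          square_integrable_row_mean true_grad_square_integrable)
  qed (use L_pos in simp)
  then show ?thesis
    by (simp add: power_mult_distrib power_divide)
qed

definition expected_loss :: "nat \<Rightarrow> real" where
  "expected_loss t = (\<integral>w. global_loss D F (mean t w) \<partial>M)"

text \<open>The inner product of the gradient with the mean of the true local gradients is polarised into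
  half the sum of the squared norms minus half the squared bias. The condition \<open>\<eta> L \<le> 1\<close> lets the
  squared norm of the mean local gradient absorb the second order term.\<close>

lemma expected_descent:
  "\<eta> / 2 * (l2norm M (\<lambda>w. global_grad (mean t w)))\<^sup>2
    \<le> expected_loss t - expected_loss (Suc t)
      + \<eta> / 2 * (L\<^sup>2 / real CARD('n) * (l2norm M (disagreement t))\<^sup>2)
      + L * \<eta>\<^sup>2 / 2 * (\<sigma>\<^sup>2 / real CARD('n))"
proof -
  define a b e where "a = (\<lambda>w. global_grad (mean t w))"
    and "b = (\<lambda>w. row_mean (true_grad (Suc t) w))" and "e = (\<lambda>w. row_mean (noise (Suc t) w))"
  have sq: "square_integrable M a" "square_integrable M b" "square_integrable M e"
    unfolding a_def b_def e_def
    by (intro global_grad_mean_square_integrable square_integrable_row_mean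
        true_grad_square_integrable noise_square_integrable)+
  have be: "square_integrable M (\<lambda>w. b w + e w)"
    using sq(2,3) by (rule square_integrable_add)
  have ae0: "(\<integral>w. a w \<bullet> e w \<partial>M) = 0"
    unfolding a_def e_def
    by (intro integral_inner_mean_noise global_grad_mean_measurable global_grad_mean_square_integrable)
  have "b \<in> borel_measurable (history (mid_past t))"
    unfolding b_def using true_grad_measurable row_mean_linear by (rule borel_measurable_linear)
  then have be0: "(\<integral>w. b w \<bullet> e w \<partial>M) = 0"
    using sq(2) unfolding e_def by (rule integral_inner_mean_noise)
  have step: "global_loss D F (mean (Suc t) w)
      \<le> global_loss D F (mean t w) + (- \<eta>) * (a w \<bullet> (b w + e w)) + L * \<eta>\<^sup>2 / 2 * (norm (b w + e w))\<^sup>2"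
    if "w \<in> space M" for w
    using global_descent[of "mean t w" "- \<eta> *\<^sub>R (b w + e w)"] that
    by (simp add: mean_Suc sample_grad_split row_mean_add a_def b_def e_def power_mult_distrib)
  have int_ab: "integrable M (\<lambda>w. a w \<bullet> b w)" and int_ae: "integrable M (\<lambda>w. a w \<bullet> e w)"
    using sq by (auto intro: square_integrable_inner)
  have "expected_loss (Suc t) \<le> (\<integral>w. global_loss D F (mean t w) + (- \<eta>) * (a w \<bullet> (b w + e w))
      + L * \<eta>\<^sup>2 / 2 * (norm (b w + e w))\<^sup>2 \<partial>M)"
    unfolding expected_loss_def
    by (intro integral_mono step global_loss_mean_integrable Bochner_Integration.integrable_add
        integrable_mult_right square_integrable_inner square_integrable_power2 sq be)
  also have "\<dots> = expected_loss t + (- \<eta>) * (\<integral>w. a w \<bullet> (b w + e w) \<partial>M)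
      + L * \<eta>\<^sup>2 / 2 * (\<integral>w. (norm (b w + e w))\<^sup>2 \<partial>M)"
    unfolding expected_loss_def
    using global_loss_mean_integrable square_integrable_inner[OF sq(1) be] square_integrable_power2[OF be]
    by simp
  also have "(\<integral>w. a w \<bullet> (b w + e w) \<partial>M) = (\<integral>w. a w \<bullet> b w \<partial>M)"
    using int_ab int_ae ae0 by (simp add: inner_add_right)
  also have "(\<integral>w. (norm (b w + e w))\<^sup>2 \<partial>M) = (l2norm M b)\<^sup>2 + (l2norm M e)\<^sup>2"
    unfolding integral_norm_add_power2[OF sq(2,3)] be0 l2norm_power2 by simp
  finally have main: "expected_loss (Suc t) \<le> expected_loss t - \<eta> * (\<integral>w. a w \<bullet> b w \<partial>M)
      + L * \<eta>\<^sup>2 / 2 * ((l2norm M b)\<^sup>2 + (l2norm M e)\<^sup>2)"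
    by simp
  have "(l2norm M (\<lambda>w. a w - b w))\<^sup>2 = (\<integral>w. (norm (a w + (- 1) *\<^sub>R b w))\<^sup>2 \<partial>M)"
    unfolding l2norm_power2 by simp
  also have "\<dots> = (l2norm M a)\<^sup>2 - 2 * (\<integral>w. a w \<bullet> b w \<partial>M) + (l2norm M b)\<^sup>2"
    unfolding integral_norm_add_power2[OF sq(1) square_integrable_scaleR[OF sq(2)]] l2norm_power2
    by simp
  finally have polar: "(l2norm M (\<lambda>w. a w - b w))\<^sup>2
      = (l2norm M a)\<^sup>2 - 2 * (\<integral>w. a w \<bullet> b w \<partial>M) + (l2norm M b)\<^sup>2" .
  have "L * \<eta>\<^sup>2 / 2 * (l2norm M b)\<^sup>2 = \<eta> * L * (\<eta> / 2 * (l2norm M b)\<^sup>2)"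
    by (simp add: power2_eq_square)
  also have "\<dots> \<le> 1 * (\<eta> / 2 * (l2norm M b)\<^sup>2)"
    using eta_range by (intro mult_right_mono) auto
  finally have b: "L * \<eta>\<^sup>2 / 2 * (l2norm M b)\<^sup>2 \<le> \<eta> / 2 * (l2norm M b)\<^sup>2"
    by simp
  have e: "L * \<eta>\<^sup>2 / 2 * (l2norm M e)\<^sup>2 \<le> L * \<eta>\<^sup>2 / 2 * (\<sigma>\<^sup>2 / real CARD('n))"
    unfolding e_def using L_pos by (intro mult_left_mono mean_noise_moment) auto
  have bias: "\<eta> / 2 * (l2norm M (\<lambda>w. a w - b w))\<^sup>2
      \<le> \<eta> / 2 * (L\<^sup>2 / real CARD('n) * (l2norm M (disagreement t))\<^sup>2)"
    unfolding a_def b_def using eta_range by (intro mult_left_mono gradient_bias) auto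
  have "\<eta> * (\<integral>w. a w \<bullet> b w \<partial>M)
      = \<eta> / 2 * (l2norm M a)\<^sup>2 + \<eta> / 2 * (l2norm M b)\<^sup>2 - \<eta> / 2 * (l2norm M (\<lambda>w. a w - b w))\<^sup>2"
    unfolding polar by (simp add: algebra_simps)
  then have "\<eta> / 2 * (l2norm M a)\<^sup>2 \<le> expected_loss t - expected_loss (Suc t)
      + \<eta> / 2 * (L\<^sup>2 / real CARD('n) * (l2norm M (disagreement t))\<^sup>2)
      + L * \<eta>\<^sup>2 / 2 * (\<sigma>\<^sup>2 / real CARD('n))"
    using main b e bias by (simp add: distrib_left)
  then show ?thesis
    unfolding a_def .
qed

lemma average_gradient_bound:
  assumes "0 < T"
  shows "(1 / real T) * (\<Sum>t<T. \<integral>w. (norm (global_grad (mean t w)))\<^sup>2 \<partial>M)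
    \<le> 2 * (global_loss D F 0 - global_loss D F x_star) / (\<eta> * real T)
      + L * \<eta> * \<sigma>\<^sup>2 / real CARD('n)
      + L\<^sup>2 / real CARD('n) * (39 * consensus_factor * grad_size / \<kappa>)\<^sup>2"
proof -
  define B where "B = (39 * consensus_factor * grad_size / \<kappa>)\<^sup>2"
  define S where "S = (\<Sum>t<T. (l2norm M (\<lambda>w. global_grad (mean t w)))\<^sup>2)"
  define N where "N = real CARD('n)"
  have dis: "(l2norm M (disagreement t))\<^sup>2 \<le> B" for t
    unfolding B_def by (intro power_mono disagreement_moment l2norm_nonneg)
  have star: "global_loss D F x_star \<le> expected_loss T"
  proof -
    have "(\<integral>w. global_loss D F x_star \<partial>M) \<le> expected_loss T"
      unfolding expected_loss_def
      by (intro integral_mono minimizer global_loss_mean_integrable) simp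
    then show ?thesis
      by (simp add: prob_space)
  qed
  have "\<eta> / 2 * S = (\<Sum>t<T. \<eta> / 2 * (l2norm M (\<lambda>w. global_grad (mean t w)))\<^sup>2)"
    unfolding S_def by (rule sum_distrib_left)
  also have "\<dots> \<le> (\<Sum>t<T. expected_loss t - expected_loss (Suc t)
      + (\<eta> / 2 * (L\<^sup>2 / N * B) + L * \<eta>\<^sup>2 / 2 * (\<sigma>\<^sup>2 / N)))"
  proof (rule sum_mono)
    fix t
    have "\<eta> / 2 * (L\<^sup>2 / N * (l2norm M (disagreement t))\<^sup>2) \<le> \<eta> / 2 * (L\<^sup>2 / N * B)"
      using eta_range dis unfolding N_def by (intro mult_left_mono) auto
    then show "\<eta> / 2 * (l2norm M (\<lambda>w. global_grad (mean t w)))\<^sup>2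
        \<le> expected_loss t - expected_loss (Suc t)
          + (\<eta> / 2 * (L\<^sup>2 / N * B) + L * \<eta>\<^sup>2 / 2 * (\<sigma>\<^sup>2 / N))"
      using expected_descent[of t] unfolding N_def by linarith
  qed
  also have "\<dots> = expected_loss 0 - expected_loss T
      + real T * (\<eta> / 2 * (L\<^sup>2 / N * B) + L * \<eta>\<^sup>2 / 2 * (\<sigma>\<^sup>2 / N))"
    by (simp add: sum.distrib sum_lessThan_telescope')
  also have "expected_loss 0 = global_loss D F 0"
  proof -
    have "expected_loss 0 = (\<integral>w. global_loss D F 0 \<partial>M)"
      unfolding expected_loss_def by (intro Bochner_Integration.integral_cong) (simp_all add: mean_0)
    then show ?thesis
      by (simp add: prob_space)
  qed
  finally have "\<eta> / 2 * S \<le> global_loss D F 0 - global_loss D F x_star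
      + real T * (\<eta> / 2 * (L\<^sup>2 / N * B) + L * \<eta>\<^sup>2 / 2 * (\<sigma>\<^sup>2 / N))"
    using star by linarith
  moreover have "1 / real T * S = 2 / (\<eta> * real T) * (\<eta> / 2 * S)"
    using eta_range by simp
  ultimately have "1 / real T * S \<le> 2 / (\<eta> * real T) * (global_loss D F 0 - global_loss D F x_star
      + real T * (\<eta> / 2 * (L\<^sup>2 / N * B) + L * \<eta>\<^sup>2 / 2 * (\<sigma>\<^sup>2 / N)))"
    using eta_range by (simp only:) (intro mult_left_mono, auto)
  also have "\<dots> = 2 * (global_loss D F 0 - global_loss D F x_star) / (\<eta> * real T)
      + L * \<eta> * \<sigma>\<^sup>2 / N + L\<^sup>2 / N * B"
  proof -
    have "2 / (\<eta> * real T) * (real T * (\<eta> / 2 * (L\<^sup>2 / N * B) + L * \<eta>\<^sup>2 / 2 * (\<sigma>\<^sup>2 / N)))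
        = L\<^sup>2 / N * B + L * \<eta> * \<sigma>\<^sup>2 / N"
      using eta_range assms by (simp add: field_simps power2_eq_square)
    then show ?thesis
      by (simp add: distrib_left)
  qed
  finally show ?thesis
    unfolding S_def l2norm_power2 N_def B_def .
qed

end


section \<open>Convergence rate\<close>

theorem theorem4:
  fixes E :: "('n::finite \<times> 'n) set"
    and W :: "real^'n^'n" and \<phi> :: "real^'n"
    and \<delta> C \<kappa> \<beta> \<omega> \<sigma> G L \<gamma> \<eta> C6 C7 :: real
    and D :: "'n \<Rightarrow> 's measure" and F :: "'n \<Rightarrow> real^'d \<Rightarrow> 's \<Rightarrow> real"
    and R :: "'r measure" and Q :: "real^'d \<Rightarrow> 'r \<Rightarrow> real^'d"
    and M :: "'w measure"
    and \<xi> :: "'n \<Rightarrow> nat \<Rightarrow> 'w \<Rightarrow> 's" and \<rho> :: "'n \<Rightarrow> nat \<Rightarrow> 'w \<Rightarrow> 'r"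
    and X Xh U Z :: "nat \<Rightarrow> 'w \<Rightarrow> real^'d^'n" and y :: "nat \<Rightarrow> real^'n"
    and x_star :: "real^'d" and T :: nat
  assumes mixing: "mixing_matrix E W \<phi> \<delta> C \<kappa>"
    and beta: "\<beta> = spectral_norm (W - mat 1)"
    and losses: "stochastic_losses D F"
    and minimizer: "\<And>x. global_loss D F x_star \<le> global_loss D F x"
    and randomness: "push_sum_randomness M D R \<xi> \<rho>"
    and omega: "0 < \<omega>" "\<omega> \<le> 1"
    and seed_space: "prob_space R"
    and Q_measurable: "(\<lambda>(v, r). Q v r) \<in> borel_measurable (borel \<Otimes>\<^sub>M R)"
    and compression: "\<And>x. integrable R (\<lambda>r. (norm (Q x r - x))\<^sup>2) \<and>
      (\<integral>r. (norm (Q x r - x))\<^sup>2 \<partial>R) \<le> (1 - \<omega>) * (norm x)\<^sup>2"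
    and bounded_variance: "\<And>i x.
      integrable (D i) (\<lambda>s. (norm (grad (\<lambda>u. F i u s) x - grad (local_loss D F i) x))\<^sup>2) \<and>
      (\<integral>s. (norm (grad (\<lambda>u. F i u s) x - grad (local_loss D F i) x))\<^sup>2 \<partial>D i) \<le> \<sigma>\<^sup>2"
    and bounded_gradients: "\<And>i x.
      integrable (D i) (\<lambda>s. (norm (grad (\<lambda>u. F i u s) x))\<^sup>2) \<and>
      (\<integral>s. (norm (grad (\<lambda>u. F i u s) x))\<^sup>2 \<partial>D i) \<le> G\<^sup>2"
    and L_pos: "0 < L"
    and smooth: "\<And>i x x'.
      norm (grad (local_loss D F i) x - grad (local_loss D F i) x') \<le> L * norm (x - x')"
    and T: "CARD('n) \<le> T"
    and eta: "\<eta> = sqrt (real CARD('n)) / (L * sqrt (real T))"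
    and gamma: "\<gamma> = \<omega> * \<delta> / (12 * \<beta> * (\<beta> + 1) * (C + 1))"
    and gamma_range: "0 < \<gamma>" "\<gamma> \<le> 1"
    and iteration: "push_sum_iteration (space M) W F Q \<xi> \<rho> \<gamma> \<eta> X Xh U Z y"
    and init_X: "\<And>w. w \<in> space M \<Longrightarrow> X 0 w = 0"
    and init_Xh: "\<And>w. w \<in> space M \<Longrightarrow> Xh 0 w = 0"
    and init_y: "y 0 = 1"
    and C6: "C6 = 2 * L * (global_loss D F 0 - global_loss D F x_star) + \<sigma>\<^sup>2"
    and C7: "C7 = 3264 * C\<^sup>2 * (C + 1)\<^sup>2 * \<beta>\<^sup>2 * (\<beta> + 1)\<^sup>2 * G\<^sup>2 * real CARD('n)
                   / (\<omega>\<^sup>2 * \<delta> ^ 4 * \<kappa>\<^sup>2)"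
  shows "(\<forall>t<T. integrable M (\<lambda>w. (norm (grad (global_loss D F) (row_mean (X t w))))\<^sup>2)) \<and>
    (1 / real T) * (\<Sum>t<T. \<integral>w. (norm (grad (global_loss D F) (row_mean (X t w))))\<^sup>2 \<partial>M)
      \<le> C6 / sqrt (real CARD('n) * real T) + C7 / real T"
proof -
  let ?n = "real CARD('n)"
  have n: "0 < ?n" and Tn: "?n \<le> real T" and T0: "0 < T"
    using T by (auto intro: less_le_trans[OF zero_less_card_finite])
  have eta_pos: "0 < \<eta>"
    unfolding eta using L_pos T0 by simp
  have "\<eta> * L = sqrt (?n / real T)"
    unfolding eta using L_pos by (simp add: real_sqrt_divide)
  also have "\<dots> \<le> 1"
    using Tn T0 by simp
  finally have eta_L: "\<eta> * L \<le> 1" .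
  interpret compressed_push_sum E W \<phi> \<delta> C \<kappa> D F M R \<xi> \<rho> Q \<gamma> \<eta> X Xh U Z y \<omega> \<sigma> G L x_star
    using mixing losses randomness iteration omega Q_measurable compression bounded_variance
      bounded_gradients minimizer L_pos smooth gamma_range gamma eta_pos eta_L init_X init_Xh init_y
    unfolding beta
    by (intro compressed_push_sum.intro compressed_push_sum_axioms.intro) auto
  have integrable: "integrable M (\<lambda>w. (norm (global_grad (row_mean (X t w))))\<^sup>2)" for t
    using square_integrable_power2[OF global_grad_mean_square_integrable] unfolding mean_def .
  have loss_gap: "2 * (global_loss D F 0 - global_loss D F x_star) / (\<eta> * real T)
      = 2 * L * (global_loss D F 0 - global_loss D F x_star) / sqrt (?n * real T)"
  proof -
    have "\<eta> * real T = sqrt ?n * (real T / sqrt (real T)) / L"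
      unfolding eta by simp
    also have "\<dots> = sqrt (?n * real T) / L"
      by (simp add: real_div_sqrt real_sqrt_mult)
    finally have "\<eta> * real T = sqrt (?n * real T) / L" .
    then show ?thesis
      by simp
  qed
  have variance: "L * \<eta> * \<sigma>\<^sup>2 / ?n = \<sigma>\<^sup>2 / sqrt (?n * real T)"
  proof -
    have "L * \<eta> / ?n = sqrt ?n / (?n * sqrt (real T))"
      unfolding eta using L_pos by simp
    also have "\<dots> = 1 / sqrt (?n * real T)"
      using n T0 by (simp add: real_sqrt_mult real_div_sqrt field_simps)
    finally have "L * \<eta> / ?n * \<sigma>\<^sup>2 = 1 / sqrt (?n * real T) * \<sigma>\<^sup>2"
      by simp
    then show ?thesis
      by simp
  qed
  have consensus: "L\<^sup>2 / ?n * (39 * consensus_factor * grad_size / \<kappa>)\<^sup>2 \<le> C7 / real T"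
  proof -
    have "\<eta>\<^sup>2 * L\<^sup>2 = ?n / real T"
      unfolding eta using L_pos T0 by (simp add: power_divide power_mult_distrib)
    \<comment> \<open>\<open>1521 = 39\<^sup>2\<close>\<close>
    moreover have "L\<^sup>2 / ?n * (39 * consensus_factor * grad_size / \<kappa>)\<^sup>2
        = 1521 * (\<eta>\<^sup>2 * L\<^sup>2) * (consensus_factor\<^sup>2 * G\<^sup>2 / \<kappa>\<^sup>2)"
      unfolding grad_size_def using n
      by (simp add: power_divide power_mult_distrib mult_ac)
    ultimately have "L\<^sup>2 / ?n * (39 * consensus_factor * grad_size / \<kappa>)\<^sup>2
        = 1521 * (?n / real T) * (consensus_factor\<^sup>2 * G\<^sup>2 / \<kappa>\<^sup>2)"
      by simp
    also have "\<dots> \<le> 3264 * (?n / real T) * (consensus_factor\<^sup>2 * G\<^sup>2 / \<kappa>\<^sup>2)"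
      by (intro mult_right_mono) auto
    also have "\<dots> = C7 / real T"
      unfolding C7 consensus_factor_def beta
      by (simp add: power_divide power_mult_distrib mult_ac)
    finally show ?thesis .
  qed
  have "(1 / real T) * (\<Sum>t<T. \<integral>w. (norm (global_grad (row_mean (X t w))))\<^sup>2 \<partial>M)
      \<le> C6 / sqrt (?n * real T) + C7 / real T"
    using average_gradient_bound[OF T0] consensus
    unfolding loss_gap variance mean_def C6 by (simp add: add_divide_distrib)
  with integrable show ?thesis
    by blast
qed

end
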